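(* Let $f:\mathbb{T}\to(0,\infty)$ be a function in $L^2(\mathbb{T})$ with Fourier series $f=\sum_{n\in\mathbb{Z}}c_ne^{2\pi inx}$ satisfying $c_n=o(1/|n|)$ as $|n|\to\infty$. Then for each irrational $\alpha$ the set of $\beta\in\mathbb{T}$ for which the equation $$f(x+\beta)-f(x)=g(x+\alpha)-g(x)\quad\text{for a.e. }x\in\mathbb{T}$$ has a solution $g\in L^2(\mathbb{T})$ is uncountable. Equivalently, the essential liftable centralizer $C^{\rm lift}(T^f)/\{T^f_t:t\in\mathbb{R}\}$ of the special flow $T^f$ over $T=R_\alpha:x\mapsto x+\alpha\bmod 1$ is uncountable.
   Context: $\mathbb{T}=[0,1)$ is the additive circle with Lebesgue measure $\mu$. For an ergodic automorphism $T$ of a standard probability space $(X,\mathcal{B},\mu)$ and $f:X\to(0,\infty)$ in $L^1$, put $f^{(n)}(x)=\sum_{i=0}^{n-1}f(T^ix)$ for $n>0$, $f^{(0)}=0$, extended to $n<0$ by $f^{(m+n)}(x)=f^{(n)}(x)+f^{(m)}(T^nx)$. The special flow $T^f$ acts on $X^f=\{(x,s):x\in X,\ 0\le s<f(x)\}$, with the normalized restriction of $\mu\otimes\lambda_{\mathbb{R}}$, by $T^f_t(x,s)=(T^nx,\,t+s-f^{(n)}(x))$, where $n$ is the unique integer with $f^{(n)}(x)\le t+s<f^{(n+1)}(x)$. Liftable centralizer. Let $T_f(x,r)=(Tx,r+f(x))$ on $X\times\mathbb{R}$. The space $X^f$ is identified with the space of $T_f$-orbits in $X\times\mathbb{R}$,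 the special flow becoming the quotient of $\sigma_t(x,r)=(x,r+t)$. If $S$ is an automorphism of $(X,\mathcal B,\mu)$ commuting with $T$ and $g:X\to\mathbb{R}$ is measurable with $f\circ S-f=g\circ T-g$ a.e., then $S_g(x,r)=(Sx,r+g(x))$ commutes with $T_f$ and with all $\sigma_t$, hence induces an automorphism $\widetilde{S_g}$ of $X^f$ commuting with $T^f$. $C^{\rm lift}(T^f)$ is the group of all such $\widetilde{S_g}$; it contains $\{T^f_t:t\in\mathbb{R}\}$ as a normal subgroup. *)

theory Defs
  imports "HOL-Analysis.Analysis" "HOL-Library.Landau_Symbols" "HOL-Algebra.Coset"
begin

text \<open>Integer iterates of a bijection \<open>T\<close> of the set \<open>X\<close>.\<close>

definition iter :: "'a set \<Rightarrow> ('a \<Rightarrow> 'a) \<Rightarrow> int \<Rightarrow> 'a \<Rightarrow> 'a" where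
  "iter X T n = (if 0 \<le> n then T ^^ nat n else inv_into X T ^^ nat (- n))"

text \<open>For \<open>n < 0\<close> the cocycle identity with \<open>m = -n\<close> forces
  \<open>f\<^sup>(\<^sup>n\<^sup>)(x) = - f\<^sup>(\<^sup>-\<^sup>n\<^sup>)(T\<^sup>n x)\<close>; see \<open>birkhoff_cocycle\<close> below.\<close>

definition birkhoff :: "'a set \<Rightarrow> ('a \<Rightarrow> 'a) \<Rightarrow> ('a \<Rightarrow> real) \<Rightarrow> int \<Rightarrow> 'a \<Rightarrow> real" where
  "birkhoff X T f n x =
     (if 0 \<le> n then \<Sum>i<nat n. f ((T ^^ i) x)
      else - (\<Sum>i<nat (- n). f ((T ^^ i) (iter X T n x))))"


subsection \<open>Automorphisms modulo null sets\<close>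

definition automorphism :: "'a measure \<Rightarrow> ('a \<Rightarrow> 'a) \<Rightarrow> bool" where
  "automorphism M S \<longleftrightarrow>
     S \<in> M \<rightarrow>\<^sub>M M \<and> distr M M S = M \<and>
     (\<exists>S'. S' \<in> M \<rightarrow>\<^sub>M M \<and> distr M M S' = M \<and>
        (AE x in M. S' (S x) = x) \<and> (AE x in M. S (S' x) = x))"

text \<open>The class consists of all maps that agree with \<open>h\<close> almost everywhere; they need not be
  measurable, and their values on a null set may lie outside \<open>space M\<close>.\<close>

definition ae_class :: "'a measure \<Rightarrow> ('a \<Rightarrow> 'a) \<Rightarrow> ('a \<Rightarrow> 'a) set" where
  "ae_class M h = {k. AE x in M. k x = h x}"

definition Aut :: "'a measure \<Rightarrow> ('a \<Rightarrow> 'a) set monoid" where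
  "Aut M = \<lparr>carrier = {ae_class M h | h. automorphism M h},
            mult = (\<lambda>A B. {k. \<exists>a\<in>A. \<exists>b\<in>B. AE x in M. k x = a (b x)}),
            one = ae_class M id\<rparr>"


subsection \<open>Special flows\<close>

text \<open>Here \<open>T\<close> is an automorphism of \<open>M\<close> that is a genuine bijection of \<open>space M\<close>.\<close>

definition flow_set :: "'a measure \<Rightarrow> ('a \<Rightarrow> real) \<Rightarrow> ('a \<times> real) set" where
  "flow_set M f = {(x, s). x \<in> space M \<and> 0 \<le> s \<and> s < f x}"

definition flow_space :: "'a measure \<Rightarrow> ('a \<Rightarrow> real) \<Rightarrow> ('a \<times> real) measure" where
  "flow_space M f =
     scale_measure (1 / emeasure (M \<Otimes>\<^sub>M lborel) (flow_set M f))
       (restrict_space (M \<Otimes>\<^sub>M lborel) (flow_set M f))"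

definition special_flow ::
    "'a measure \<Rightarrow> ('a \<Rightarrow> 'a) \<Rightarrow> ('a \<Rightarrow> real) \<Rightarrow> real \<Rightarrow> 'a \<times> real \<Rightarrow> 'a \<times> real" where
  "special_flow M T f t = (\<lambda>(x, s).
     let n = (THE n. birkhoff (space M) T f n x \<le> t + s \<and> t + s < birkhoff (space M) T f (n + 1) x)
     in (iter (space M) T n x, t + s - birkhoff (space M) T f n x))"


subsection \<open>The liftable centralizer\<close>

definition skew :: "('a \<Rightarrow> 'a) \<Rightarrow> ('a \<Rightarrow> real) \<Rightarrow> 'a \<times> real \<Rightarrow> 'a \<times> real" where
  "skew S g = (\<lambda>(x, r). (S x, r + g x))"

definition skew_orbit :: "'a measure \<Rightarrow> ('a \<Rightarrow> 'a) \<Rightarrow> ('a \<Rightarrow> real) \<Rightarrow> 'a \<times> real \<Rightarrow> ('a \<times> real) set" where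
  "skew_orbit M T f p = range (\<lambda>n. iter (space M \<times> UNIV) (skew T f) n p)"

text \<open>With \<open>T\<^sub>f(x, r) = (T x, r + f x)\<close>, the points \<open>(x, f x)\<close> and \<open>(T x, 0)\<close>, which are glued
  in the special flow, are not on one orbit, but \<open>(x, - f x)\<close> and \<open>(T x, 0)\<close> are.  Hence
  \<open>(x, s) \<in> X\<^sup>f\<close> is identified with the orbit of \<open>(x, - s)\<close>.  The special flow at time \<open>t\<close> is then
  the quotient of \<open>(x, r) \<mapsto> (x, r - t)\<close> (see \<open>special_flow_eq_induced\<close>).  Working with
  \<open>(x, r) \<mapsto> (T x, r - f x)\<close> and \<open>(x, r) \<mapsto> (S x, r - g x)\<close> and identifying \<open>(x, s)\<close> with its own
  orbit gives the same induced maps.\<close>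

definition orbit_rep :: "'a measure \<Rightarrow> ('a \<Rightarrow> real) \<Rightarrow> ('a \<times> real) set \<Rightarrow> 'a \<times> real" where
  "orbit_rep M f Q = (THE q. q \<in> flow_set M f \<and> (fst q, - snd q) \<in> Q)"

definition induced ::
    "'a measure \<Rightarrow> ('a \<Rightarrow> 'a) \<Rightarrow> ('a \<Rightarrow> real) \<Rightarrow> ('a \<Rightarrow> 'a) \<Rightarrow> ('a \<Rightarrow> real) \<Rightarrow> 'a \<times> real \<Rightarrow> 'a \<times> real" where
  "induced M T f S g = (\<lambda>(x, s). orbit_rep M f (skew_orbit M T f (skew S g (x, - s))))"

definition lift_centralizer ::
    "'a measure \<Rightarrow> ('a \<Rightarrow> 'a) \<Rightarrow> ('a \<Rightarrow> real) \<Rightarrow> ('a \<times> real \<Rightarrow> 'a \<times> real) set monoid" where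
  "lift_centralizer M T f = (Aut (flow_space M f))
     \<lparr>carrier := {ae_class (flow_space M f) (induced M T f S g) | S g.
        automorphism M S \<and> (AE x in M. S (T x) = T (S x)) \<and>
        g \<in> borel_measurable M \<and> (AE x in M. f (S x) - f x = g (T x) - g x)}\<rparr>"

definition flow_subgroup ::
    "'a measure \<Rightarrow> ('a \<Rightarrow> 'a) \<Rightarrow> ('a \<Rightarrow> real) \<Rightarrow> ('a \<times> real \<Rightarrow> 'a \<times> real) set set" where
  "flow_subgroup M T f = range (\<lambda>t. ae_class (flow_space M f) (special_flow M T f t))"


subsection \<open>The circle\<close>

abbreviation circle :: "real measure" where
  "circle \<equiv> lebesgue_on {0..<1}"

definition rotation :: "real \<Rightarrow> real \<Rightarrow> real" where
  "rotation \<alpha> x = frac (x + \<alpha>)"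

definition square_integrable :: "'a measure \<Rightarrow> ('a \<Rightarrow> real) \<Rightarrow> bool" where
  "square_integrable M f \<longleftrightarrow> f \<in> borel_measurable M \<and> integrable M (\<lambda>x. (f x)\<^sup>2)"

definition fourier_coeff :: "(real \<Rightarrow> real) \<Rightarrow> int \<Rightarrow> complex" where
  "fourier_coeff f n = (LINT x|circle. complex_of_real (f x) * exp (- 2 * pi * \<i> * of_int n * x))"


subsection \<open>Consistency of the conventions\<close>

lemma
  assumes T: "bij_betw T X X" and x: "x \<in> X"
  shows iter_add1: "iter X T (n + 1) x = T (iter X T n x)" and iter_in: "iter X T n x \<in> X"
proof -
  have inX: "(T ^^ k) x \<in> X" "(inv_into X T ^^ k) x \<in> X" for k
    using T x by (induction k) (auto simp: bij_betw_def inv_into_into)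
  then show "iter X T n x \<in> X" by (simp add: iter_def)
  show "iter X T (n + 1) x = T (iter X T n x)"
  proof (cases "0 \<le> n")
    case True
    then show ?thesis by (simp add: iter_def nat_add_distrib)
  next
    case False
    then obtain k where k: "n = - int (Suc k)"
      by (metis add.commute int_cases not_less of_nat_0_le_iff of_nat_Suc)
    have "T (inv_into X T ((inv_into X T ^^ k) x)) = (inv_into X T ^^ k) x"
      using T inX(2)[of k] by (simp add: bij_betw_def f_inv_into_f)
    then show ?thesis using k by (cases k) (simp_all add: iter_def nat_add_distrib)
  qed
qed

lemma iter_unique:
  assumes T: "bij_betw T X X" and h: "\<And>n. h n \<in> X" "\<And>n. h (n + 1) = T (h n)"
  shows "iter X T n (h 0) = h n"
proof (induction n rule: int_induct[of _ 0])
  case base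
  then show ?case by (simp add: iter_def)
next
  case (step1 i)
  then show ?case using iter_add1[OF T h(1)] h(2) by simp
next
  case (step2 i)
  have "T (iter X T (i - 1) (h 0)) = T (h (i - 1))"
    using iter_add1[OF T h(1), of "i - 1" 0] h(2)[of "i - 1"] step2 by simp
  then show ?case
    using T h(1) iter_in[OF T h(1)] by (metis bij_betw_imp_inj_on inj_onD)
qed

lemma iter_add:
  assumes T: "bij_betw T X X" and x: "x \<in> X"
  shows "iter X T (m + n) x = iter X T m (iter X T n x)"
proof -
  have "iter X T (m + 1 + n) x = T (iter X T (m + n) x)" for m
    using iter_add1[OF T x, of "m + n"] by (metis add.assoc add.commute)
  from iter_unique[OF T, of "\<lambda>m. iter X T (m + n) x" m, OF iter_in[OF T x] this]
  show ?thesis by simp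
qed

lemma birkhoff_add1:
  assumes T: "bij_betw T X X" and x: "x \<in> X"
  shows "birkhoff X T f (n + 1) x = birkhoff X T f n x + f (iter X T n x)"
proof (cases "0 \<le> n")
  case True
  then show ?thesis by (simp add: birkhoff_def iter_def nat_add_distrib)
next
  case False
  then obtain k where k: "n = - int (Suc k)"
    by (metis add.commute int_cases not_less of_nat_0_le_iff of_nat_Suc)
  then have n1: "n + 1 = - int k" by simp
  have "birkhoff X T f (n + 1) x = - (\<Sum>i<k. f ((T ^^ i) (T (iter X T n x))))"
    unfolding birkhoff_def iter_add1[OF T x, symmetric] n1 by simp
  moreover have "birkhoff X T f n x = - (\<Sum>i<Suc k. f ((T ^^ i) (iter X T n x)))"
  proof -
    have "\<not> 0 \<le> n" "nat (- n) = Suc k" using k by simp_all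
    then show ?thesis by (simp only: birkhoff_def if_False)
  qed
  ultimately show ?thesis
    by (simp add: sum.lessThan_Suc_shift funpow_swap1 del: sum.lessThan_Suc)
qed

lemma birkhoff_cocycle:
  assumes T: "bij_betw T X X" and x: "x \<in> X"
  shows "birkhoff X T f (m + n) x = birkhoff X T f n x + birkhoff X T f m (iter X T n x)"
proof (induction m rule: int_induct[of _ 0])
  case base
  then show ?case by (simp add: birkhoff_def)
next
  case (step1 i)
  have *: "i + 1 + n = i + n + 1" by simp
  show ?case
    unfolding * birkhoff_add1[OF T x] birkhoff_add1[OF T iter_in[OF T x]] step1(2)
    by (simp add: iter_add[OF T x])
next
  case (step2 i)
  define j where "j = i - 1"
  have i: "i = j + 1" and *: "j + 1 + n = j + n + 1" by (simp_all add: j_def)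
  have "birkhoff X T f (j + n) x + f (iter X T (j + n) x)
      = birkhoff X T f n x + (birkhoff X T f j (iter X T n x) + f (iter X T j (iter X T n x)))"
    using step2(2)
    unfolding i * birkhoff_add1[OF T x] birkhoff_add1[OF T iter_in[OF T x]] .
  then show ?case
    by (simp add: iter_add[OF T x] j_def[symmetric])
qed

lemma iter_skew:
  assumes T: "bij_betw T X X" and x: "x \<in> X"
  shows "iter (X \<times> UNIV) (skew T f) n (x, r) = (iter X T n x, r + birkhoff X T f n x)"
proof -
  have "inj_on (skew T f) (X \<times> UNIV)"
    using T by (auto simp: inj_on_def skew_def bij_betw_def)
  moreover have "skew T f ` (X \<times> UNIV) = X \<times> UNIV"
  proof (intro equalityI subsetI)
    fix p assume "p \<in> X \<times> (UNIV :: real set)"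
    then have "fst p \<in> T ` X" using T by (auto simp: bij_betw_def)
    then obtain y s where p: "p = (T y, s)" "y \<in> X"
      by (cases p) auto
    then have "p = skew T f (y, s - f y)" by (simp add: skew_def)
    then show "p \<in> skew T f ` (X \<times> UNIV)" using p(2) by blast
  qed (use T in \<open>auto simp: skew_def bij_betw_def\<close>)
  ultimately have "bij_betw (skew T f) (X \<times> UNIV) (X \<times> UNIV)"
    by (simp add: bij_betw_def)
  from iter_unique[OF this, of "\<lambda>n. (iter X T n x, r + birkhoff X T f n x)" n]
  have "iter (X \<times> UNIV) (skew T f) n (iter X T 0 x, r + birkhoff X T f 0 x)
      = (iter X T n x, r + birkhoff X T f n x)"
    by (simp add: iter_in[OF T x] iter_add1[OF T x] birkhoff_add1[OF T x] skew_def)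
  moreover have "iter X T 0 x = x" "birkhoff X T f 0 x = 0"
    by (simp_all add: iter_def birkhoff_def)
  ultimately show ?thesis by simp
qed

lemma special_flow_eq_induced:
  assumes T: "bij_betw T (space M) (space M)" and x: "x \<in> space M"
    and ex1: "\<exists>!n. birkhoff (space M) T f n x \<le> t + s \<and> t + s < birkhoff (space M) T f (n + 1) x"
  shows "special_flow M T f t (x, s) = induced M T f id (\<lambda>_. - t) (x, s)"
proof -
  let ?P = "\<lambda>n. birkhoff (space M) T f n x \<le> t + s \<and> t + s < birkhoff (space M) T f (n + 1) x"
  let ?q = "\<lambda>n. (iter (space M) T n x, t + s - birkhoff (space M) T f n x)"
  obtain n where n: "?P n" and uniq: "\<And>m. ?P m \<Longrightarrow> m = n" using ex1 by blast
  have orb: "skew_orbit M T f (x, - s - t)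
      = range (\<lambda>m. (iter (space M) T m x, - s - t + birkhoff (space M) T f m x))"
    by (simp add: skew_orbit_def iter_skew[OF T x])
  have *: "?q m \<in> flow_set M f \<longleftrightarrow> ?P m" for m
    using iter_in[OF T x] birkhoff_add1[OF T x, of f m] by (auto simp: flow_set_def)
  have "(fst q, - snd q) \<in> skew_orbit M T f (x, - s - t) \<longleftrightarrow> (\<exists>m. q = ?q m)" for q
    unfolding orb by (cases q) (auto simp: image_iff algebra_simps)
  then have "orbit_rep M f (skew_orbit M T f (x, - s - t)) = ?q n"
    unfolding orbit_rep_def
    by (intro the_equality) (use * n uniq in metis)+
  moreover have "(THE m. ?P m) = n" using n uniq by (rule the_equality)
  ultimately show ?thesis
    by (simp add: special_flow_def induced_def skew_def)
qed

end

theory Submission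
  imports Defs
begin

text \<open>
  Put \<open>f\<^sub>0 = f - c\<^sub>0\<close> and let \<open>S\<^sub>q\<close> denote Birkhoff sums of length \<open>q\<close> over the rotation by \<open>\<alpha>\<close>.
  Let \<open>p / q\<close> be reduced with \<open>\<bar>q \<alpha> - p\<bar> < 1 / N \<le> 1 / q\<close> (Dirichlet).  The \<open>n\<close>-th Fourier coefficient of
  \<open>S\<^sub>q h\<close> is that of \<open>h\<close> times \<open>D\<^sub>q n = \<Sum>j<q. exp (2 \<pi> \<i> n j \<alpha>)\<close>.  The Denjoy--Koksma inequality for the sawtooth
  \<open>x - 1/2\<close>, whose coefficients have modulus \<open>1 / (2 \<pi> \<bar>n\<bar>)\<close>, and Bessel's inequality bound
  \<open>\<Sum>n\<noteq>0. \<bar>D\<^sub>q n\<bar>\<^sup>2 / n\<^sup>2\<close> independently of \<open>q\<close>, while every single \<open>D\<^sub>q n\<close> with \<open>n \<noteq> 0\<close> tends to \<open>0\<close>.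
  Hence \<open>c\<^sub>n = o(1/\<bar>n\<bar>)\<close> makes \<open>S\<^sub>q f\<^sub>0\<close> arbitrarily small in \<open>L\<^sup>2\<close> while \<open>q \<alpha>\<close> is
  arbitrarily close to an integer \<open>p\<close>.

  Choose such \<open>q\<^sub>k\<close> with \<open>d\<^sub>k = q\<^sub>k \<alpha> - p\<^sub>k\<close> decaying geometrically.  The sums of \<open>d\<^sub>k\<close> over sets \<open>A\<close> of
  indices are distinct modulo \<open>1\<close> and hence form an uncountable set of \<open>\<beta>\<close>; the Birkhoff sums of \<open>f\<^sub>0\<close> along
  the partial sums converge in \<open>L\<^sup>2\<close> to a solution \<open>g\<close>, as one checks on Fourier coefficients.

  Two of these \<open>\<beta>\<close> can give the same coset of the flow only if they differ by an element of
  \<open>\<int> \<alpha> + \<int>\<close>: both the flow and the orbit representatives move the base point along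
  its orbit under the rotation by \<open>\<alpha>\<close>.
\<close>

subsection \<open>Rotations of the circle\<close>

lemma rotation_ge_0 [simp]: "0 \<le> rotation a x" and rotation_lt_1 [simp]: "rotation a x < 1"
  by (simp_all add: rotation_def frac_lt_1)

lemma rotation_rotation: "rotation a (rotation b x) = rotation (b + a) x"
proof -
  have "x + b - of_int \<lfloor>x + b\<rfloor> + a = (x + (b + a)) + of_int (- \<lfloor>x + b\<rfloor>)" by simp
  then show ?thesis unfolding rotation_def frac_def by (simp add: algebra_simps)
qed

lemma rotation_cong: "a - b \<in> \<int> \<Longrightarrow> rotation a x = rotation b x"
proof (elim Ints_cases)
  fix z assume "a - b = real_of_int z"
  then have "x + a = (x + b) + real_of_int z" by simp
  then have "frac (x + a) = frac ((x + b) + real_of_int z)" by (rule arg_cong)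
  then show ?thesis unfolding rotation_def frac_def by (simp only: floor_add_int of_int_add) simp
qed

lemma rotation_frac [simp]: "rotation (frac b) = rotation b"
  by (intro ext rotation_cong) (simp add: frac_def)

lemma rotation_0: "x \<in> {0..<1} \<Longrightarrow> rotation 0 x = x"
  by (simp add: rotation_def frac_eq)

lemma bij_betw_rotation: "bij_betw (rotation a) {0..<1} {0..<1}"
  by (rule bij_betw_byWitness[where f' = "rotation (- a)"])
     (auto simp: rotation_rotation rotation_0)

lemma lebesgue_measurable_shift: "(\<lambda>x. x + c) \<in> lebesgue \<rightarrow>\<^sub>M (lebesgue :: real measure)"
  using lebesgue_affine_measurable[of "\<lambda>_. 1" c] by (simp add: add.commute)

text \<open>On \<open>{0..<1}\<close> the rotation consists of two translations, cut at
  \<open>1 - frac a\<close>, so measurability follows from that of translations for Lebesgue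
  measure.\<close>

lemma measurable_rotation [measurable]: "rotation a \<in> circle \<rightarrow>\<^sub>M circle"
proof -
  let ?b = "frac a"
  have "(\<lambda>x. if x < 1 - ?b then x + ?b else x + (?b - 1)) \<in> lebesgue \<rightarrow>\<^sub>M lebesgue"
    by (intro measurable_If lebesgue_measurable_shift) auto
  then have "(\<lambda>x. if x < 1 - ?b then x + ?b else x + (?b - 1)) \<in> circle \<rightarrow>\<^sub>M lebesgue"
    by (rule measurable_restrict_space1)
  also have "?this \<longleftrightarrow> rotation a \<in> circle \<rightarrow>\<^sub>M lebesgue"
  proof (rule measurable_cong)
    fix x assume "x \<in> space circle"
    then have x: "0 \<le> x" "x < 1" by auto
    have b: "0 \<le> ?b" "?b < 1" by (auto simp: frac_lt_1)
    have "frac (x + ?b) = (if x < 1 - ?b then x + ?b else x + (?b - 1))"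
      using x b frac_eq[of "x + ?b"] frac_eq[of "x + (?b - 1)"] frac_1_eq[of "x + (?b - 1)"]
      by (auto simp: algebra_simps)
    then show "(if x < 1 - ?b then x + ?b else x + (?b - 1)) = rotation a x"
      by (metis rotation_def rotation_frac)
  qed
  finally show ?thesis
    by (intro measurable_restrict_space2) auto
qed

text \<open>Cutting \<open>A\<close> at \<open>frac a\<close> makes the preimage a disjoint union of
  two translates, whose Lebesgue measures add up to that of \<open>A\<close>.\<close>

lemma emeasure_rotation_vimage:
  assumes A: "A \<in> sets circle"
  shows "emeasure circle (rotation a -` A \<inter> {0..<1}) = emeasure circle A"
proof -
  let ?b = "frac a"
  have b: "0 \<le> ?b" "?b < 1" by (auto simp: frac_lt_1)
  have sA: "A \<in> sets lebesgue" "A \<subseteq> {0..<1}" using A by (auto simp: sets_restrict_space)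
  let ?A1 = "A \<inter> {?b..}" and ?A2 = "A \<inter> {..< ?b}"
  have m: "?A1 \<in> sets lebesgue" "?A2 \<in> sets lebesgue" using sA by auto
  have "emeasure lebesgue ((\<lambda>x. 1 *\<^sub>R x + d) ` B) = emeasure lebesgue B" for d and B :: "real set"
    using emeasure_lebesgue_affine[of 1 d B] by simp
  then have sh: "emeasure lebesgue ((\<lambda>x. x + d) ` B) = emeasure lebesgue B" for d and B :: "real set"
    by simp
  have shm: "(\<lambda>x. x + d) ` B \<in> sets lebesgue" if "B \<in> sets lebesgue" for d and B :: "real set"
  proof -
    have "(\<lambda>x. x + d) ` B = (\<lambda>x. x + (- d)) -` B" by (force simp: image_iff)
    then show ?thesis using measurable_sets[OF lebesgue_measurable_shift that, of "- d"] by simp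
  qed
  have eq: "rotation a -` A \<inter> {0..<1} = (\<lambda>x. x + (- ?b)) ` ?A1 \<union> (\<lambda>x. x + (1 - ?b)) ` ?A2" (is "?L = ?R")
  proof (intro equalityI subsetI)
    fix x assume x: "x \<in> ?L"
    then have "frac (x + ?b) \<in> A" by (metis rotation_def rotation_frac vimageE IntD1)
    moreover have "frac (x + ?b) = (if x < 1 - ?b then x + ?b else x + (?b - 1))"
      using x b frac_eq[of "x + ?b"] frac_eq[of "x + (?b - 1)"] frac_1_eq[of "x + (?b - 1)"]
      by (auto simp: algebra_simps)
    ultimately have "x + ?b \<in> ?A1 \<or> x + (?b - 1) \<in> ?A2" using x by (auto split: if_splits)
    then show "x \<in> ?R"
    proof
      assume "x + ?b \<in> ?A1"
      then have "x + ?b + (- ?b) \<in> ?R" by blast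
      then show ?thesis by simp
    next
      assume "x + (?b - 1) \<in> ?A2"
      then have "x + (?b - 1) + (1 - ?b) \<in> ?R" by blast
      then show ?thesis by simp
    qed
  next
    fix x assume "x \<in> ?R"
    then consider y where "y \<in> A" "?b \<le> y" "x = y - ?b" | y where "y \<in> A" "y < ?b" "x = y + 1 - ?b" by auto
    then show "x \<in> ?L"
    proof cases
      case 1
      then have "x + ?b = y" by simp
      then have "rotation ?b x = y" unfolding rotation_def using sA(2) 1 frac_eq[of y] by auto
      moreover have "y < 1" using subsetD[OF sA(2) 1(1)] by simp
      then have "x < 1" using 1(3) b by linarith
      ultimately show ?thesis using 1 by auto
    next
      case 2
      then have "x + ?b = y + 1" by simp
      then have "rotation ?b x = y" unfolding rotation_def using sA(2) 2 frac_eq[of y] frac_1_eq[of y] by auto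
      moreover have "0 \<le> x" "x < 1" using 2(2,3) subsetD[OF sA(2) 2(1)] b by simp_all
      ultimately show ?thesis using 2 by auto
    qed
  qed
  have "emeasure circle ?L = emeasure lebesgue ?L"
    by (rule emeasure_restrict_space) auto
  also have "\<dots> = emeasure lebesgue ((\<lambda>x. x + (- ?b)) ` ?A1) + emeasure lebesgue ((\<lambda>x. x + (1 - ?b)) ` ?A2)"
    unfolding eq
  proof (intro plus_emeasure[symmetric] shm m equals0I)
    fix z assume "z \<in> (\<lambda>x. x + (- ?b)) ` ?A1 \<inter> (\<lambda>x. x + (1 - ?b)) ` ?A2"
    then obtain y y' where "y \<in> A" "y' \<in> A" "y + (- ?b) = y' + (1 - ?b)" by auto
    then show False using subsetD[OF sA(2), of y] subsetD[OF sA(2), of y'] by simp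
  qed
  also have "\<dots> = emeasure lebesgue ?A1 + emeasure lebesgue ?A2" by (simp only: sh)
  also have "\<dots> = emeasure lebesgue (?A1 \<union> ?A2)" using m by (intro plus_emeasure) auto
  also have "?A1 \<union> ?A2 = A" by auto
  also have "emeasure lebesgue A = emeasure circle A"
    using sA by (intro emeasure_restrict_space[symmetric]) auto
  finally show ?thesis .
qed

lemma distr_rotation: "distr circle circle (rotation a) = circle"
  by (rule measure_eqI) (auto simp: emeasure_distr emeasure_rotation_vimage)

lemma automorphism_rotation: "automorphism circle (rotation a)"
  unfolding automorphism_def
proof (intro conjI exI[of _ "rotation (- a)"])
qed (auto simp: distr_rotation rotation_rotation rotation_0 intro!: AE_I2)

lemma AE_rotation:
  assumes "AE x in circle. P x" shows "AE x in circle. P (rotation a x)"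
proof -
  from assms have "AE x in distr circle circle (rotation a). P x" unfolding distr_rotation .
  with AE_distrD[OF measurable_rotation] show ?thesis .
qed

lemma integral_rotation:
  fixes h :: "real \<Rightarrow> 'b::{banach, second_countable_topology}"
  assumes "h \<in> borel_measurable circle"
  shows "(LINT x|circle. h (rotation a x)) = (LINT x|circle. h x)"
  using integral_distr[OF measurable_rotation assms] by (simp add: distr_rotation)

lemma integrable_rotation:
  fixes h :: "real \<Rightarrow> 'b::{banach, second_countable_topology}"
  assumes "integrable circle h"
  shows "integrable circle (\<lambda>x. h (rotation a x))"
  using assms integrable_distr[OF measurable_rotation] by (metis distr_rotation)

lemma emeasure_circle: "emeasure circle {0..<1} = 1"
  by (subst emeasure_restrict_space) auto

lemma finite_measure_circle: "finite_measure circle"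
  by (rule finite_measureI) (simp add: emeasure_circle)

subsection \<open>Characters\<close>

text \<open>The character e(n x). It is a function on all reals, so the homomorphism laws and the
  invariance under integer shifts hold without side conditions.\<close>

definition chr :: "int \<Rightarrow> real \<Rightarrow> complex" where
  "chr n x = cis (2 * pi * of_int n * x)"

lemma norm_chr [simp]: "norm (chr n x) = 1" and chr_0 [simp]: "chr 0 x = 1"
  and chr_zero [simp]: "chr n 0 = 1"
  by (simp_all add: chr_def)

lemma chr_add: "chr (m + n) x = chr m x * chr n x"
  and chr_plus: "chr n (x + y) = chr n x * chr n y"
  and cnj_chr: "cnj (chr n x) = chr (- n) x"
  by (simp_all add: chr_def cis_mult cis_cnj algebra_simps)

lemma chr_int [simp]: "chr n (of_int k) = 1"
proof -
  have "2 * pi * of_int n * of_int k = 2 * pi * of_int (n * k)" by simp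
  then show ?thesis unfolding chr_def by (simp only: cis_multiple_2pi Ints_of_int)
qed

lemma chr_frac [simp]: "chr n (frac x) = chr n x"
proof -
  have "chr n x = chr n (frac x + of_int \<lfloor>x\<rfloor>)" by (simp add: frac_def)
  then show ?thesis by (simp only: chr_plus chr_int mult_1_right)
qed

lemma chr_rotation: "chr n (rotation a x) = chr n x * chr n a"
  by (simp add: rotation_def chr_plus)

lemma continuous_chr [continuous_intros]: "continuous_on S (chr n)"
  unfolding chr_def by (intro continuous_intros)

lemma borel_measurable_lebesgue_onI:
  "f \<in> borel_measurable borel \<Longrightarrow> f \<in> borel_measurable (lebesgue_on S)"
  by (intro measurable_restrict_space1 measurable_completion) simp

lemma measurable_chr [measurable]: "chr n \<in> borel_measurable circle"
  by (intro borel_measurable_lebesgue_onI borel_measurable_continuous_onI continuous_intros)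

lemma fourier_coeff_chr: "fourier_coeff h n = (LINT x|circle. of_real (h x) * chr (- n) x)"
  by (simp add: fourier_coeff_def chr_def cis_conv_exp algebra_simps)

interpretation circle: finite_measure circle
  by (rule finite_measure_circle)

lemma integrable_chr [simp]: "integrable circle (chr n)"
  by (rule circle.integrable_const_bound[where B = 1]) auto

text \<open>For \<open>n \<noteq> 0\<close>, rotating by half a period, \<open>1 / (2 * n)\<close>,
  changes the sign of \<open>chr n\<close> but not its integral, so the integral equals its own
  negative.\<close>

lemma integral_chr: "(LINT x|circle. chr n x) = (if n = 0 then 1 else 0)"
proof (cases "n = 0")
  case True
  then show ?thesis using emeasure_circle by (simp add: measure_def)
next
  case False
  define b where "b = 1 / (2 * real_of_int n)"
  have "chr n b = -1" using False by (simp add: chr_def b_def)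
  then have "(LINT x|circle. chr n x) = (LINT x|circle. - chr n x)"
    using integral_rotation[OF measurable_chr[of n], of b] by (simp add: chr_rotation)
  then show ?thesis using False by simp
qed

subsection \<open>Square integrable functions\<close>

text \<open>The circle has finite measure and |h| <= 1 + h^2, so square integrable functions are
  integrable and have Fourier coefficients.\<close>

lemma sq_intD:
  assumes "square_integrable circle h"
  shows "h \<in> borel_measurable circle" "integrable circle (\<lambda>x. (h x)\<^sup>2)" "integrable circle h"
    "integrable circle (\<lambda>x. \<bar>h x\<bar>)"
proof -
  show m: "h \<in> borel_measurable circle" and i: "integrable circle (\<lambda>x. (h x)\<^sup>2)"
    using assms by (auto simp: square_integrable_def)
  have "integrable circle (\<lambda>x. 1 + (h x)\<^sup>2)" using i by simp
  then show "integrable circle h"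
  proof (rule Bochner_Integration.integrable_bound)
    have "\<bar>h x\<bar> \<le> 1 + (h x)\<^sup>2" for x
      using sum_squares_bound[of 1 "\<bar>h x\<bar>"] abs_ge_zero[of "h x"] by simp
    then show "AE x in circle. norm (h x) \<le> norm (1 + (h x)\<^sup>2)" by simp
  qed (use m in auto)
  then show "integrable circle (\<lambda>x. \<bar>h x\<bar>)" by simp
qed

lemma sq_int_bound:
  assumes "h \<in> borel_measurable circle" "square_integrable circle k" "AE x in circle. \<bar>h x\<bar> \<le> \<bar>k x\<bar>"
  shows "square_integrable circle h"
  unfolding square_integrable_def
proof
  show "integrable circle (\<lambda>x. (h x)\<^sup>2)"
    using sq_intD(2)[OF assms(2)]
    by (rule Bochner_Integration.integrable_bound)
       (use assms in \<open>auto simp: abs_le_square_iff\<close>)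
qed (rule assms)

lemma sq_int_add:
  assumes h: "square_integrable circle h" and k: "square_integrable circle k"
  shows "square_integrable circle (\<lambda>x. h x + k x)"
  unfolding square_integrable_def
proof
  note [measurable] = sq_intD(1)[OF h] sq_intD(1)[OF k]
  show "(\<lambda>x. h x + k x) \<in> borel_measurable circle" by measurable
  have "integrable circle (\<lambda>x. 2 * (h x)\<^sup>2 + 2 * (k x)\<^sup>2)"
    using sq_intD(2)[OF h] sq_intD(2)[OF k] by simp
  then show "integrable circle (\<lambda>x. (h x + k x)\<^sup>2)"
  proof (rule Bochner_Integration.integrable_bound)
    have "(h x + k x)\<^sup>2 \<le> 2 * (h x)\<^sup>2 + 2 * (k x)\<^sup>2" for x
      using sum_squares_bound[of "h x" "k x"] by (simp add: power2_sum)
    then show "AE x in circle. norm ((h x + k x)\<^sup>2) \<le> norm (2 * (h x)\<^sup>2 + 2 * (k x)\<^sup>2)" by simp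
  qed auto
qed

lemma sq_int_cmult: "square_integrable circle h \<Longrightarrow> square_integrable circle (\<lambda>x. c * h x)"
  by (auto simp: square_integrable_def power_mult_distrib)

lemma sq_int_diff:
  "square_integrable circle h \<Longrightarrow> square_integrable circle k \<Longrightarrow> square_integrable circle (\<lambda>x. h x - k x)"
  using sq_int_add[OF _ sq_int_cmult[of k "-1"]] by simp

lemma sq_int_bounded:
  assumes "h \<in> borel_measurable circle" "\<And>x. \<lbrakk>0 \<le> x; x < 1\<rbrakk> \<Longrightarrow> \<bar>h x\<bar> \<le> B"
  shows "square_integrable circle h"
  unfolding square_integrable_def
proof
  show "integrable circle (\<lambda>x. (h x)\<^sup>2)"
  proof (rule circle.integrable_const_bound[where B = "B\<^sup>2"])
    show "AE x in circle. norm ((h x)\<^sup>2) \<le> B\<^sup>2"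
      using power_mono[OF assms(2) abs_ge_zero, of _ 2] by (intro AE_I2) auto
  qed (use assms in auto)
qed (rule assms)

lemma sq_int_rotation:
  "square_integrable circle h \<Longrightarrow> square_integrable circle (\<lambda>x. h (rotation a x))"
  unfolding square_integrable_def
  by (auto intro: integrable_rotation[of "\<lambda>x. (h x)\<^sup>2"] measurable_compose[OF measurable_rotation])

lemma sq_int_sum:
  "(\<And>i. i \<in> I \<Longrightarrow> square_integrable circle (h i)) \<Longrightarrow> square_integrable circle (\<lambda>x. \<Sum>i\<in>I. h i x)"
  by (induction I rule: infinite_finite_induct)
     (auto intro: sq_int_add sq_int_bounded[where B = 0])

subsection \<open>Fourier coefficients\<close>

lemma integrable_mult_chr:
  assumes "integrable circle (h :: real \<Rightarrow> complex)" shows "integrable circle (\<lambda>x. h x * chr n x)"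
  using assms by (rule Bochner_Integration.integrable_bound)
    (use borel_measurable_integrable[OF assms] in \<open>auto simp: norm_mult\<close>)

lemma integrable_of_real_chr:
  "integrable circle h \<Longrightarrow> integrable circle (\<lambda>x. complex_of_real (h x) * chr n x)"
  by (intro integrable_mult_chr) simp

lemma fourier_diff:
  assumes "integrable circle h" "integrable circle k"
  shows "fourier_coeff (\<lambda>x. h x - k x) n = fourier_coeff h n - fourier_coeff k n"
  using assms[THEN integrable_of_real_chr, of "- n"]
  by (simp add: fourier_coeff_chr left_diff_distrib)

lemma fourier_sum:
  assumes "\<And>i. i \<in> I \<Longrightarrow> integrable circle (h i)"
  shows "fourier_coeff (\<lambda>x. \<Sum>i\<in>I. h i x) n = (\<Sum>i\<in>I. fourier_coeff (h i) n)"
  unfolding fourier_coeff_chr of_real_sum sum_distrib_right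
  by (rule Bochner_Integration.integral_sum) (intro integrable_of_real_chr assms)

lemma fourier_const: "fourier_coeff (\<lambda>x. c) n = (if n = 0 then of_real c else 0)"
  using integral_chr[of "- n"] by (simp add: fourier_coeff_chr)

lemma fourier_rotation:
  assumes "integrable circle h"
  shows "fourier_coeff (\<lambda>x. h (rotation a x)) n = chr n a * fourier_coeff h n"
proof -
  have [measurable]: "h \<in> borel_measurable circle" using assms by simp
  have "chr n a * fourier_coeff h n = chr n a * (LINT x|circle. of_real (h (rotation a x)) * chr (- n) (rotation a x))"
    unfolding fourier_coeff_chr by (subst integral_rotation[symmetric, where a = a]) auto
  also have "\<dots> = (LINT x|circle. chr n a * (of_real (h (rotation a x)) * chr (- n) (rotation a x)))"
    by (rule integral_mult_right_zero[symmetric])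
  also have "\<dots> = (LINT x|circle. of_real (h (rotation a x)) * chr (- n) x)"
  proof (rule Bochner_Integration.integral_cong)
    fix x
    have "chr n a * chr (- n) a = 1" by (simp flip: chr_add)
    then show "chr n a * (of_real (h (rotation a x)) * chr (- n) (rotation a x))
      = of_real (h (rotation a x)) * chr (- n) x"
      by (simp add: chr_rotation algebra_simps)
  qed simp
  finally show ?thesis by (simp add: fourier_coeff_chr)
qed

text \<open>Completing the square: this yields both Bessel's inequality and the optimality of partial
  Fourier sums.\<close>

lemma dist_trig_poly:
  assumes h: "square_integrable circle h" and I: "finite I"
  shows "integrable circle (\<lambda>x. (norm (of_real (h x) - (\<Sum>n\<in>I. p n * chr n x)))\<^sup>2)"
    and "(LINT x|circle. (norm (of_real (h x) - (\<Sum>n\<in>I. p n * chr n x)))\<^sup>2)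
      = (LINT x|circle. (h x)\<^sup>2) - (\<Sum>n\<in>I. (norm (fourier_coeff h n))\<^sup>2)
        + (\<Sum>n\<in>I. (norm (p n - fourier_coeff h n))\<^sup>2)"
proof -
  define P where "P = (\<lambda>x. \<Sum>n\<in>I. p n * chr n x)"
  let ?c = "fourier_coeff h"
  note hi = sq_intD(2,3)[OF h]
  \<comment> \<open>Since \<open>h\<close> is real, conjugating a coefficient only conjugates the
    character.\<close>
  have cnjc: "cnj (?c n) = (LINT x|circle. of_real (h x) * chr n x)" for n
    unfolding fourier_coeff_chr Bochner_Integration.integral_cnj[symmetric] by (simp add: cnj_chr)
  have hP: "of_real (h x) * P x = (\<Sum>n\<in>I. p n * (of_real (h x) * chr n x))" for x
    by (simp add: P_def sum_distrib_left algebra_simps)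
  have PP: "P x * cnj (P x) = (\<Sum>n\<in>I. \<Sum>m\<in>I. p n * cnj (p m) * chr (n - m) x)" for x
    by (simp add: P_def sum_product cnj_chr chr_add[of _ "- _", simplified] algebra_simps)
  have i1: "integrable circle (\<lambda>x. of_real (h x) * P x)"
    unfolding hP by (intro Bochner_Integration.integrable_sum integrable_mult_right integrable_of_real_chr hi)
  have i2: "integrable circle (\<lambda>x. P x * cnj (P x))"
    unfolding PP by (intro Bochner_Integration.integrable_sum integrable_mult_right integrable_chr)
  have I1: "(LINT x|circle. of_real (h x) * P x) = (\<Sum>n\<in>I. p n * cnj (?c n))"
    unfolding hP cnjc
    by (subst Bochner_Integration.integral_sum) (auto intro!: integrable_of_real_chr hi)
  have I2: "(LINT x|circle. P x * cnj (P x)) = (\<Sum>n\<in>I. of_real ((norm (p n))\<^sup>2))"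
  proof -
    have "(LINT x|circle. P x * cnj (P x)) = (\<Sum>n\<in>I. \<Sum>m\<in>I. p n * cnj (p m) * (if n - m = 0 then 1 else 0))"
      unfolding PP by (subst Bochner_Integration.integral_sum, simp)+
        (simp add: integral_chr)
    also have "\<dots> = (\<Sum>n\<in>I. p n * cnj (p n))"
      using I by (intro sum.cong refl) (simp add: if_distrib[of "\<lambda>x. _ * x"] sum.delta' cong: if_cong)
    finally show ?thesis by (simp only: complex_norm_square)
  qed
  have eq: "(norm (of_real (h x) - P x))\<^sup>2 = (h x)\<^sup>2 - 2 * Re (of_real (h x) * P x) + Re (P x * cnj (P x))" for x
  proof -
    have "(norm (of_real (h x) - P x))\<^sup>2 = (h x - Re (P x))\<^sup>2 + (Im (P x))\<^sup>2"
      by (simp add: cmod_power2)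
    then show ?thesis by (simp add: power2_eq_square algebra_simps)
  qed
  show "integrable circle (\<lambda>x. (norm (of_real (h x) - (\<Sum>n\<in>I. p n * chr n x)))\<^sup>2)"
    unfolding P_def[symmetric, THEN fun_cong] eq using i1 i2 hi by (simp del: times_complex.sel)
  have "(LINT x|circle. (norm (of_real (h x) - P x))\<^sup>2)
    = (LINT x|circle. (h x)\<^sup>2) - 2 * Re (LINT x|circle. of_real (h x) * P x) + Re (LINT x|circle. P x * cnj (P x))"
    unfolding eq using i1 i2 hi by (simp del: times_complex.sel)
  also have "\<dots> = (LINT x|circle. (h x)\<^sup>2) + (\<Sum>n\<in>I. (norm (p n))\<^sup>2 - 2 * Re (p n * cnj (?c n)))"
    unfolding I1 I2 by (simp add: sum_subtractf sum_distrib_left flip: of_real_sum)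
  also have "(\<Sum>n\<in>I. (norm (p n))\<^sup>2 - 2 * Re (p n * cnj (?c n)))
    = (\<Sum>n\<in>I. (norm (p n - ?c n))\<^sup>2 - (norm (?c n))\<^sup>2)"
    by (intro sum.cong refl, unfold cmod_power2) (simp add: power2_eq_square algebra_simps)
  finally show "(LINT x|circle. (norm (of_real (h x) - (\<Sum>n\<in>I. p n * chr n x)))\<^sup>2)
      = (LINT x|circle. (h x)\<^sup>2) - (\<Sum>n\<in>I. (norm (?c n))\<^sup>2) + (\<Sum>n\<in>I. (norm (p n - ?c n))\<^sup>2)"
    by (simp add: P_def sum_subtractf algebra_simps)
qed

text \<open>With the Fourier coefficients as \<open>p\<close>, the last sum of
  \<open>dist_trig_poly\<close> vanishes, and the integral on its left is nonnegative.\<close>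

lemma bessel:
  assumes "square_integrable circle h" "finite I"
  shows "(\<Sum>n\<in>I. (norm (fourier_coeff h n))\<^sup>2) \<le> (LINT x|circle. (h x)\<^sup>2)"
proof -
  have "0 \<le> (LINT x|circle. (norm (of_real (h x) - (\<Sum>n\<in>I. fourier_coeff h n * chr n x)))\<^sup>2)"
    by (rule Bochner_Integration.integral_nonneg) auto
  then show ?thesis by (subst (asm) dist_trig_poly(2)[OF assms]) simp
qed

subsection \<open>Density of trigonometric polynomials\<close>

definition trig_poly :: "(real \<Rightarrow> complex) \<Rightarrow> bool" where
  "trig_poly P \<longleftrightarrow> (\<exists>I p. finite I \<and> P = (\<lambda>x. \<Sum>n\<in>I. p n * chr n x))"

lemma trig_poly_chr: "trig_poly (\<lambda>x. c * chr n x)"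
  unfolding trig_poly_def by (intro exI[of _ "{n}"] exI[of _ "\<lambda>_. c"]) simp

lemma trig_poly_const: "trig_poly (\<lambda>x. c)"
  using trig_poly_chr[of c 0] by simp

lemma trig_poly_add:
  assumes "trig_poly P" "trig_poly Q" shows "trig_poly (\<lambda>x. P x + Q x)"
proof -
  obtain I p J q where I: "finite I" "P = (\<lambda>x. \<Sum>n\<in>I. p n * chr n x)"
    and J: "finite J" "Q = (\<lambda>x. \<Sum>n\<in>J. q n * chr n x)"
    using assms by (auto simp: trig_poly_def)
  \<comment> \<open>Padding by \<open>0\<close> puts both sums over the common index set
    \<open>I \<union> J\<close>.\<close>
  let ?p = "\<lambda>n. if n \<in> I then p n else 0" and ?q = "\<lambda>n. if n \<in> J then q n else 0"
  have "P x + Q x = (\<Sum>n\<in>I \<union> J. (?p n + ?q n) * chr n x)" for x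
  proof -
    have "P x = (\<Sum>n\<in>I \<union> J. ?p n * chr n x)"
      unfolding I(2) using I(1) J(1) by (intro sum.mono_neutral_cong_left) auto
    moreover have "Q x = (\<Sum>n\<in>I \<union> J. ?q n * chr n x)"
      unfolding J(2) using I(1) J(1) by (intro sum.mono_neutral_cong_left) auto
    ultimately show ?thesis by (simp only: distrib_right sum.distrib)
  qed
  then have "(\<lambda>x. P x + Q x) = (\<lambda>x. \<Sum>n\<in>I \<union> J. (?p n + ?q n) * chr n x)" by (rule ext)
  moreover have "finite (I \<union> J)" using I J by simp
  ultimately show ?thesis unfolding trig_poly_def by (intro exI[of _ "I \<union> J"] exI[of _ "\<lambda>n. ?p n + ?q n"] conjI)
qed

lemma trig_poly_sum: "(\<And>i. i \<in> I \<Longrightarrow> trig_poly (P i)) \<Longrightarrow> trig_poly (\<lambda>x. \<Sum>i\<in>I. P i x)"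
  by (induction I rule: infinite_finite_induct) (simp_all add: trig_poly_add trig_poly_const)

lemma trig_poly_mult:
  assumes "trig_poly P" "trig_poly Q" shows "trig_poly (\<lambda>x. P x * Q x)"
proof -
  obtain I p J q where P: "P = (\<lambda>x. \<Sum>n\<in>I. p n * chr n x)" and Q: "Q = (\<lambda>x. \<Sum>n\<in>J. q n * chr n x)"
    using assms by (auto simp: trig_poly_def)
  have "P x * Q x = (\<Sum>n\<in>I. \<Sum>m\<in>J. p n * q m * chr (n + m) x)" for x
    by (simp add: P Q sum_product chr_add algebra_simps)
  then show ?thesis by (simp add: trig_poly_sum trig_poly_chr)
qed

text \<open>Stone--Weierstrass yields real polynomials in the two coordinates of a point of the unit
  circle. These coordinates are combinations of \<open>chr 1\<close> and \<open>chr (-1)\<close>,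
  and products of characters are characters.\<close>

lemma trig_poly_real_polynomial:
  assumes "real_polynomial_function r"
  shows "trig_poly (\<lambda>x. of_real (r (chr 1 x)))"
  using assms
proof induction
  case (linear r)
  interpret r: bounded_linear r by fact
  have "r z = Re z * r 1 + Im z * r \<i>" for z
  proof -
    have "z = Re z *\<^sub>R 1 + Im z *\<^sub>R \<i>" by (simp add: complex_eq_iff)
    then have "r z = r (Re z *\<^sub>R 1 + Im z *\<^sub>R \<i>)" by (rule arg_cong)
    then show ?thesis by (simp only: r.add r.scaleR real_scaleR_def)
  qed
  moreover have "complex_of_real (Re (chr 1 x)) = 1/2 * chr 1 x + 1/2 * chr (-1) x"
    "complex_of_real (Im (chr 1 x)) = - \<i>/2 * chr 1 x + \<i>/2 * chr (-1) x" for x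
    by (auto simp: chr_def complex_eq_iff)
  ultimately have "complex_of_real (r (chr 1 x)) = (1/2 * chr 1 x + 1/2 * chr (-1) x) * of_real (r 1)
      + (- \<i>/2 * chr 1 x + \<i>/2 * chr (-1) x) * of_real (r \<i>)" for x
    by (metis of_real_add of_real_mult)
  then show ?case
    by (simp only:) (intro trig_poly_add trig_poly_mult trig_poly_chr trig_poly_const)
next
  case (const c)
  show ?case by (rule trig_poly_const)
qed (simp_all add: trig_poly_add trig_poly_mult)

text \<open>The condition \<open>F 0 = F 1\<close> makes \<open>F\<close> a continuous function
  \<open>\<phi>\<close> on the unit circle of the complex plane, to which Stone--Weierstrass
  applies.\<close>

lemma trig_poly_dense_continuous:
  fixes F :: "real \<Rightarrow> real"
  assumes F: "continuous_on {0..1} F" and F01: "F 0 = F 1" and e: "0 < e"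
  obtains P where "trig_poly P" "\<And>x. \<lbrakk>0 \<le> x; x \<le> 1\<rbrakk> \<Longrightarrow> norm (of_real (F x) - P x) < e"
proof -
  \<comment> \<open>The angle divided by \<open>2 * pi\<close>, read off from the real part: it is
    right on the upper half circle and has to be replaced by \<open>1 - ?a z\<close> on the lower
    one.\<close>
  let ?a = "\<lambda>z. arccos (Re z) / (2 * pi)"
  define \<phi> where "\<phi> = (\<lambda>z. if 0 \<le> Im z then F (?a z) else F (1 - ?a z))"
  let ?U = "sphere (0::complex) 1 \<inter> {z. 0 \<le> Im z}" and ?L = "sphere (0::complex) 1 \<inter> {z. Im z \<le> 0}"
  have re: "-1 \<le> Re z \<and> Re z \<le> 1" if "z \<in> sphere 0 1" for z
    using that abs_Re_le_cmod[of z] by auto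
  have a: "0 \<le> ?a z \<and> ?a z \<le> 1" if "z \<in> sphere 0 1" for z
    using re[OF that] arccos_bounded[of "Re z"] by (auto simp: field_simps)
  have ca: "continuous_on (sphere 0 1) ?a"
    using re by (intro continuous_intros) auto
  have "continuous_on (?U \<union> ?L) \<phi>"
    unfolding \<phi>_def
  proof (rule continuous_on_cases)
    show "closed ?U" "closed ?L"
      by (auto intro!: closed_Int closed_halfspace_Im_ge closed_halfspace_Im_le)
    show "continuous_on ?U (\<lambda>z. F (?a z))" "continuous_on ?L (\<lambda>z. F (1 - ?a z))"
      using a by (intro continuous_on_compose2[OF F] continuous_on_diff continuous_on_const
          continuous_on_subset[OF ca]; force)+
    show "\<forall>z. z \<in> ?U \<and> \<not> 0 \<le> Im z \<or> z \<in> ?L \<and> 0 \<le> Im z \<longrightarrow> F (?a z) = F (1 - ?a z)"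
    proof (intro allI impI)
      fix z assume "z \<in> ?U \<and> \<not> 0 \<le> Im z \<or> z \<in> ?L \<and> 0 \<le> Im z"
      then have "Im z = 0" "norm z = 1" by auto
      \<comment> \<open>The half circles meet in \<open>1\<close> and \<open>-1\<close>. At
        \<open>1\<close> the two formulas give \<open>F 0\<close> and \<open>F 1\<close>, at
        \<open>-1\<close> both give \<open>F (1/2)\<close>.\<close>
      then have "Re z = 1 \<or> Re z = -1" by (auto simp: cmod_def abs_if split: if_splits)
      then show "F (?a z) = F (1 - ?a z)" using F01 by auto
    qed
  qed
  moreover have "?U \<union> ?L = sphere 0 1" by auto
  ultimately have "continuous_on (sphere 0 1) \<phi>" by simp
  then obtain r where r: "real_polynomial_function r" "\<And>z. z \<in> sphere 0 1 \<Longrightarrow> \<bar>\<phi> z - r z\<bar> < e"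
    using Stone_Weierstrass_real_polynomial_function[OF compact_sphere _ e] by metis
  have phi: "\<phi> (chr 1 x) = F x" if x: "0 \<le> x" "x \<le> 1" for x
  proof (cases "x \<le> 1/2")
    case True
    then have "0 \<le> 2 * pi * x" "2 * pi * x \<le> pi" using x by auto
    then show ?thesis
      unfolding \<phi>_def chr_def by (simp add: sin_ge_zero arccos_cos)
  next
    case False
    then have "pi * (1 / 2) < pi * x" by (intro mult_strict_left_mono) auto
    moreover have "pi * x \<le> pi" using x by simp
    ultimately have y: "0 \<le> 2 * pi - 2 * pi * x" "2 * pi - 2 * pi * x < pi" by simp_all
    have c: "cos (2 * pi * x) = cos (2 * pi - 2 * pi * x)" and s: "sin (2 * pi * x) = - sin (2 * pi - 2 * pi * x)"
      by (simp_all add: cos_diff sin_diff)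
    have ar: "arccos (cos (2 * pi * x)) = 2 * pi - 2 * pi * x" unfolding c using y by (intro arccos_cos) auto
    show ?thesis
    \<comment> \<open>At \<open>x = 1\<close> the point \<open>chr 1 x\<close> is \<open>1\<close>
      and belongs to the upper branch, so \<open>\<phi>\<close> returns \<open>F 0\<close>.\<close>
    proof (cases "x = 1")
      case True
      then show ?thesis using F01 by (simp add: \<phi>_def chr_def)
    next
      case False
      with x y have "0 < sin (2 * pi - 2 * pi * x)" by (intro sin_gt_zero) auto
      then have "\<not> 0 \<le> Im (chr 1 x)" unfolding chr_def using s by (simp only: cis.sel of_int_1 mult_1_right)
      then have "\<phi> (chr 1 x) = F (1 - ?a (chr 1 x))" unfolding \<phi>_def by (rule if_not_P)
      moreover have "?a (chr 1 x) = (2 * pi - 2 * pi * x) / (2 * pi)"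
        unfolding chr_def by (simp only: cis.sel of_int_1 mult_1_right ar)
      moreover have "(2 * pi - 2 * pi * x) / (2 * pi) = 1 - x" by (simp add: diff_divide_distrib)
      ultimately show ?thesis by simp
    qed
  qed
  show thesis
  proof
    show "trig_poly (\<lambda>x. of_real (r (chr 1 x)))" by (rule trig_poly_real_polynomial) fact
    fix x :: real assume "0 \<le> x" "x \<le> 1"
    then have "\<bar>F x - r (chr 1 x)\<bar> < e" using r(2)[of "chr 1 x"] phi by simp
    then show "norm (complex_of_real (F x) - of_real (r (chr 1 x))) < e" by (simp flip: of_real_diff)
  qed
qed

text \<open>Lebesgue measurability supplies continuous functions converging almost everywhere to
  \<open>h\<close> on the interval. They are clipped at \<open>M\<close> for dominated convergence
  and multiplied by a cutoff that vanishes at both end points, which forces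
  \<open>F 0 = F 1\<close>.\<close>

lemma bounded_L2_approx:
  fixes h :: "real \<Rightarrow> real"
  assumes h: "h \<in> borel_measurable circle" and M: "\<And>x. \<bar>h x\<bar> \<le> M" and e: "0 < e"
  obtains F where "continuous_on {0..1} F" "F 0 = F 1" "(LINT x|circle. (h x - F x)\<^sup>2) < e"
proof -
  have "h measurable_on {0..<1}" using h by (subst measurable_on_iff_borel_measurable) auto
  then obtain N g where N: "negligible N" and g: "\<And>n. continuous_on UNIV (g n)"
    and lim: "\<And>x. x \<notin> N \<Longrightarrow> (\<lambda>n. g n x) \<longlonglongrightarrow> (if x \<in> {0..<1} then h x else 0)"
    unfolding measurable_on_def by blast
  define F where "F = (\<lambda>(n::nat) x. max (- M) (min M (g n x)) * min 1 (real n * (x * (1 - x))))"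
  have F: "continuous_on S (F n)" for n S
    unfolding F_def by (intro continuous_intros continuous_on_subset[OF g]) auto
  have M0: "0 \<le> M" using M[of 0] by linarith
  have FM: "\<bar>F n x\<bar> \<le> M" if "0 \<le> x" "x < 1" for n x
  proof -
    have "\<bar>max (- M) (min M (g n x))\<bar> \<le> M" using M0 by auto
    moreover have "\<bar>min 1 (real n * (x * (1 - x)))\<bar> \<le> 1"
    proof -
      have "0 \<le> real n * (x * (1 - x))" using that by simp
      then show ?thesis by linarith
    qed
    ultimately show ?thesis unfolding F_def abs_mult using M0 mult_mono[of _ M _ 1] by fastforce
  qed
  have Fm: "F n \<in> borel_measurable circle" for n
    by (intro borel_measurable_lebesgue_onI borel_measurable_continuous_onI F)
  \<comment> \<open>The cutoff vanishes at \<open>0\<close> for every \<open>n\<close>, so that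
    point is discarded together with \<open>N\<close>.\<close>
  have nl: "AE x in circle. x \<notin> insert 0 N"
  proof -
    have "insert 0 N \<in> null_sets lebesgue" using N by (simp add: negligible_iff_null_sets)
    then have "AE x in lebesgue. x \<notin> insert 0 N" by (rule AE_not_in)
    then show ?thesis by (subst AE_restrict_space_iff) auto
  qed
  have "(\<lambda>n. LINT x|circle. (h x - F n x)\<^sup>2) \<longlonglongrightarrow> (LINT x|circle. 0)"
  proof (rule integral_dominated_convergence[where w = "\<lambda>_. (2 * M)\<^sup>2"])
    show "AE x in circle. (\<lambda>n. (h x - F n x)\<^sup>2) \<longlonglongrightarrow> 0"
      using nl AE_space
    proof eventually_elim
      case (elim x)
      then have x: "0 < x" "x < 1" "x \<notin> N" by auto
      then have l: "(\<lambda>n. g n x) \<longlonglongrightarrow> h x" using lim[of x] by simp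
      have "eventually (\<lambda>n. min 1 (real n * (x * (1 - x))) = 1) sequentially"
      proof -
        have pos: "0 < x * (1 - x)" using x by simp
        have "eventually (\<lambda>n. real n \<ge> 1 / (x * (1 - x))) sequentially"
          by (intro eventually_at_top_linorderI[of "nat \<lceil>1 / (x * (1 - x))\<rceil>"]) linarith
        then show ?thesis
        proof eventually_elim
          case (elim n)
          then have "1 \<le> real n * (x * (1 - x))" using pos by (simp only: pos_divide_le_eq)
          then show ?case by (rule min_absorb1)
        qed
      qed
      then have l2: "(\<lambda>n. min 1 (real n * (x * (1 - x)))) \<longlonglongrightarrow> 1" by (rule tendsto_eventually)
      have "(\<lambda>n. F n x) \<longlonglongrightarrow> max (- M) (min M (h x)) * 1"
        unfolding F_def by (intro tendsto_intros l l2)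
      also have "max (- M) (min M (h x)) * 1 = h x" using M[of x] by auto
      finally have "(\<lambda>n. (h x - F n x)\<^sup>2) \<longlonglongrightarrow> (h x - h x)\<^sup>2" by (intro tendsto_intros)
      then show ?case by simp
    qed
    show "AE x in circle. norm ((h x - F n x)\<^sup>2) \<le> (2 * M)\<^sup>2" for n
    proof (rule AE_I2)
      fix x assume "x \<in> space circle"
      then have "\<bar>h x - F n x\<bar> \<le> 2 * M" using FM[of x n] M[of x] by auto
      then show "norm ((h x - F n x)\<^sup>2) \<le> (2 * M)\<^sup>2" 
        using power_mono[OF _ abs_ge_zero, of "h x - F n x" "2 * M" 2]
        by (simp only: real_norm_def abs_power2 power2_abs)
    qed
  qed (use h Fm in auto)
  then have "eventually (\<lambda>n. (LINT x|circle. (h x - F n x)\<^sup>2) < e) sequentially"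
    using e by (intro order_tendstoD(2)) auto
  then obtain n where "(LINT x|circle. (h x - F n x)\<^sup>2) < e" by (auto simp: eventually_sequentially)
  moreover have "F n 0 = F n 1" by (simp add: F_def)
  ultimately show thesis using F that by blast
qed

text \<open>The clipping error is dominated by \<open>h\<close> itself and is eventually
  \<open>0\<close> at each point. This reduces the density statement to bounded functions.\<close>

lemma truncation_L2_approx:
  assumes h: "square_integrable circle h" and e: "0 < e"
  obtains M where "0 \<le> M" "(LINT x|circle. (h x - max (- M) (min M (h x)))\<^sup>2) < e"
proof -
  note [measurable] = sq_intD(1)[OF h]
  have "(\<lambda>n. LINT x|circle. (h x - max (- real n) (min (real n) (h x)))\<^sup>2) \<longlonglongrightarrow> (LINT x|circle. 0)"
  proof (rule integral_dominated_convergence[where w = "\<lambda>x. (h x)\<^sup>2"])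
    show "AE x in circle. (\<lambda>n. (h x - max (- real n) (min (real n) (h x)))\<^sup>2) \<longlonglongrightarrow> 0"
    proof (rule AE_I2)
      fix x
      show "(\<lambda>n. (h x - max (- real n) (min (real n) (h x)))\<^sup>2) \<longlonglongrightarrow> 0"
      proof (intro tendsto_eventually eventually_at_top_linorderI[of "nat \<lceil>\<bar>h x\<bar>\<rceil>"])
        fix n assume "nat \<lceil>\<bar>h x\<bar>\<rceil> \<le> n"
        then have "\<bar>h x\<bar> \<le> real n" by linarith
        then show "(h x - max (- real n) (min (real n) (h x)))\<^sup>2 = 0" by auto
      qed
    qed
    show "AE x in circle. norm ((h x - max (- real n) (min (real n) (h x)))\<^sup>2) \<le> (h x)\<^sup>2" for n
    proof (rule AE_I2)
      fix x
      have "\<bar>h x - max (- real n) (min (real n) (h x))\<bar> \<le> \<bar>h x\<bar>" by auto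
      then show "norm ((h x - max (- real n) (min (real n) (h x)))\<^sup>2) \<le> (h x)\<^sup>2" by (simp add: abs_le_square_iff)
    qed
  qed (use sq_intD(2)[OF h] in auto)
  then have "eventually (\<lambda>n. (LINT x|circle. (h x - max (- real n) (min (real n) (h x)))\<^sup>2) < e) sequentially"
    using e by (intro order_tendstoD(2)) auto
  then obtain n where "(LINT x|circle. (h x - max (- real n) (min (real n) (h x)))\<^sup>2) < e"
    by (auto simp: eventually_sequentially)
  then show thesis by (rule that[rotated]) simp
qed

text \<open>Truncation, a continuous periodic function and a trigonometric polynomial are chained.
  By (a + b + c)^2 <= 3 (a^2 + b^2 + c^2), squared errors of \<open>e / 9\<close> at each of the
  three stages cost at most \<open>e\<close>.\<close>

lemma trig_poly_L2_dense:
  assumes h: "square_integrable circle h" and e: "0 < e"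
  obtains P where "trig_poly P" "(LINT x|circle. (norm (of_real (h x) - P x))\<^sup>2) < e"
proof -
  obtain M where M: "0 \<le> M" "(LINT x|circle. (h x - max (- M) (min M (h x)))\<^sup>2) < e / 9"
    using truncation_L2_approx[OF h, of "e / 9"] e by auto
  define k where "k = (\<lambda>x. max (- M) (min M (h x)))"
  note [measurable] = sq_intD(1)[OF h]
  have km [measurable]: "k \<in> borel_measurable circle" unfolding k_def by measurable
  have kM: "\<bar>k x\<bar> \<le> M" for x using M(1) by (auto simp: k_def)
  obtain F where F: "continuous_on {0..1} F" "F 0 = F 1" "(LINT x|circle. (k x - F x)\<^sup>2) < e / 9"
    using bounded_L2_approx[OF km kM, of "e / 9"] e by auto
  obtain P where P: "trig_poly P" "\<And>x. \<lbrakk>0 \<le> x; x \<le> 1\<rbrakk> \<Longrightarrow> norm (of_real (F x) - P x) < sqrt (e / 9)"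
    using trig_poly_dense_continuous[OF F(1,2), of "sqrt (e / 9)"] e by auto
  have Fm [measurable]: "F \<in> borel_measurable circle"
    using continuous_imp_measurable_on_sets_lebesgue[OF continuous_on_subset[OF F(1)], of "{0..<1}"]
    by (auto simp: atLeastLessThan_subseteq_atLeastAtMost_iff)
  obtain B where B: "\<And>x. x \<in> {0..1} \<Longrightarrow> norm (F x) \<le> B"
    using compact_imp_bounded[OF compact_continuous_image[OF F(1)]] unfolding bounded_iff by fastforce
  have sk: "square_integrable circle k" using km kM by (rule sq_int_bounded)
  have sF: "square_integrable circle F" using Fm B by (intro sq_int_bounded[where B = B]) auto
  have ih: "integrable circle (\<lambda>x. (h x - k x)\<^sup>2)" and ik: "integrable circle (\<lambda>x. (k x - F x)\<^sup>2)"
    using sq_intD(2)[OF sq_int_diff[OF h sk]] sq_intD(2)[OF sq_int_diff[OF sk sF]] by auto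
  have "(LINT x|circle. (norm (of_real (h x) - P x))\<^sup>2)
      \<le> (LINT x|circle. 3 * (h x - k x)\<^sup>2 + 3 * (k x - F x)\<^sup>2 + e / 3)"
  proof (rule integral_mono_AE)
    show "integrable circle (\<lambda>x. (norm (of_real (h x) - P x))\<^sup>2)"
      using P(1) dist_trig_poly(1)[OF h] by (auto simp: trig_poly_def)
    show "AE x in circle. (norm (of_real (h x) - P x))\<^sup>2 \<le> 3 * (h x - k x)\<^sup>2 + 3 * (k x - F x)\<^sup>2 + e / 3"
    proof (rule AE_I2)
      fix x assume "x \<in> space circle"
      then have "norm (of_real (F x) - P x) < sqrt (e / 9)" using P(2) by simp
      then have "(norm (of_real (F x) - P x))\<^sup>2 \<le> (sqrt (e / 9))\<^sup>2" by (intro power_mono) auto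
      then have c: "(norm (of_real (F x) - P x))\<^sup>2 \<le> e / 9" using e by simp
      let ?a = "\<bar>h x - k x\<bar>" and ?b = "\<bar>k x - F x\<bar>" and ?c = "norm (of_real (F x) - P x)"
      have "of_real (h x) - P x = of_real (h x - k x) + of_real (k x - F x) + (of_real (F x) - P x)" by simp
      then have "norm (of_real (h x) - P x) \<le> ?a + ?b + ?c"
        by (metis norm_triangle_ineq norm_triangle_mono norm_of_real order_refl)
      then have "(norm (of_real (h x) - P x))\<^sup>2 \<le> (?a + ?b + ?c)\<^sup>2" by (intro power_mono) auto
      also have "\<dots> \<le> 3 * ?a\<^sup>2 + 3 * ?b\<^sup>2 + 3 * ?c\<^sup>2"
      proof -
        have "3 * ?a\<^sup>2 + 3 * ?b\<^sup>2 + 3 * ?c\<^sup>2 - (?a + ?b + ?c)\<^sup>2 = (?a - ?b)\<^sup>2 + (?b - ?c)\<^sup>2 + (?a - ?c)\<^sup>2"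
          unfolding power2_eq_square by (simp add: algebra_simps)
        then show ?thesis by (smt (verit) zero_le_power2)
      qed
      finally show "(norm (of_real (h x) - P x))\<^sup>2 \<le> 3 * (h x - k x)\<^sup>2 + 3 * (k x - F x)\<^sup>2 + e / 3"
        using c by simp
    qed
  qed (use ih ik in auto)
  also have "\<dots> = 3 * (LINT x|circle. (h x - k x)\<^sup>2) + 3 * (LINT x|circle. (k x - F x)\<^sup>2) + e / 3"
    using ih ik emeasure_circle by (simp add: measure_def)
  also have "\<dots> < e" using M(2) F(3) by (simp add: k_def)
  finally show thesis using P(1) that by blast
qed

text \<open>The converse of Bessel's inequality. For \<open>P\<close> close to \<open>h\<close> in
  L^2, \<open>dist_trig_poly\<close> bounds the integral by \<open>e\<close> plus the coefficient
  sum over the frequencies of \<open>P\<close>, because the term comparing the coefficients of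
  \<open>P\<close> with those of \<open>h\<close> is nonnegative.\<close>

lemma parseval_le:
  assumes h: "square_integrable circle h"
    and B: "\<And>I. finite I \<Longrightarrow> (\<Sum>n\<in>I. (norm (fourier_coeff h n))\<^sup>2) \<le> B"
  shows "(LINT x|circle. (h x)\<^sup>2) \<le> B"
proof (rule field_le_epsilon)
  fix e :: real assume "0 < e"
  then obtain P where P: "trig_poly P" "(LINT x|circle. (norm (of_real (h x) - P x))\<^sup>2) < e"
    using trig_poly_L2_dense[OF h] by blast
  then obtain I p where I: "finite I" "P = (\<lambda>x. \<Sum>n\<in>I. p n * chr n x)" by (auto simp: trig_poly_def)
  have "0 \<le> (\<Sum>n\<in>I. (norm (p n - fourier_coeff h n))\<^sup>2)" by (intro sum_nonneg) auto
  then show "(LINT x|circle. (h x)\<^sup>2) \<le> B + e"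
    using P(2) B[OF I(1)] dist_trig_poly(2)[OF h I(1), of p] I(2) by simp
qed

lemma fourier_unique:
  assumes h: "square_integrable circle h" and 0: "\<And>n. fourier_coeff h n = 0"
  shows "AE x in circle. h x = 0"
proof -
  have "(LINT x|circle. (h x)\<^sup>2) \<le> 0" by (rule parseval_le[OF h]) (simp add: 0)
  then have "(LINT x|circle. (h x)\<^sup>2) = 0" by (simp add: order_antisym)
  then show ?thesis
    using integral_nonneg_eq_0_iff_AE[OF sq_intD(2)[OF h]] by simp
qed

subsection \<open>Birkhoff sums along denominators of rational approximations\<close>

lemma frac_add_int: "frac (x + of_int k) = frac x"
  by (simp add: frac_def)

text \<open>A Birkhoff sum of natural length with rotations in place of iterates, so that Fourier
  coefficients can be computed termwise; \<open>birkhoff_rotation\<close> links such sums to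
  \<open>birkhoff\<close>.\<close>

definition rot_sum :: "real \<Rightarrow> nat \<Rightarrow> (real \<Rightarrow> real) \<Rightarrow> real \<Rightarrow> real" where
  "rot_sum \<alpha> m h x = (\<Sum>i<m. h (rotation (real i * \<alpha>) x))"

lemma sq_int_rot_sum: "square_integrable circle h \<Longrightarrow> square_integrable circle (rot_sum \<alpha> m h)"
  unfolding rot_sum_def by (intro sq_int_sum sq_int_rotation)

lemma fourier_rot_sum:
  assumes "integrable circle h"
  shows "fourier_coeff (rot_sum \<alpha> m h) n = (\<Sum>i<m. chr n (real i * \<alpha>)) * fourier_coeff h n"
  unfolding rot_sum_def
  by (simp add: fourier_sum fourier_rotation integrable_rotation assms sum_distrib_right)

text \<open>The geometric sum, multiplied out so that \<open>chr n \<alpha> = 1\<close> is no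
  exception.\<close>

lemma chr_sum: "(\<Sum>i<m. chr n (real i * \<alpha>)) * (chr n \<alpha> - 1) = chr n (real m * \<alpha>) - 1"
  by (induction m) (simp_all add: algebra_simps chr_plus)

text \<open>Applied with \<open>y = real q * \<alpha> - of_int p\<close>: together with
  \<open>chr_sum\<close> it makes the character sum of length \<open>q\<close> small at each fixed
  nonzero frequency when \<open>real q * \<alpha>\<close> is close to an integer.\<close>

lemma norm_chr_diff_1: "norm (chr n (y + of_int p) - 1) \<le> 2 * pi * \<bar>of_int n\<bar> * \<bar>y\<bar>"
proof -
  have "norm (chr n (y + of_int p) - 1) = norm (exp (\<i> * of_real (2 * pi * of_int n * y)) - 1)"
    by (simp only: chr_plus chr_int mult_1_right) (simp only: chr_def cis_conv_exp)
  also have "\<dots> = 2 * \<bar>sin (2 * pi * of_int n * y / 2)\<bar>" by (rule dist_exp_i_1)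
  also have "\<dots> \<le> 2 * \<bar>2 * pi * of_int n * y / 2\<bar>" by (intro mult_left_mono abs_sin_x_le_abs_x) auto
  also have "\<dots> = 2 * pi * \<bar>of_int n\<bar> * \<bar>y\<bar>" by (simp add: abs_mult)
  finally show ?thesis .
qed

lemma chr_irrational:
  assumes "\<alpha> \<notin> \<rat>" "n \<noteq> 0" shows "chr n \<alpha> \<noteq> 1"
proof
  assume "chr n \<alpha> = 1"
  then have "cos (2 * pi * of_int n * \<alpha>) = 1" unfolding chr_def by (metis cis.sel(1) one_complex.sel(1))
  then obtain k :: int where "2 * pi * of_int n * \<alpha> = of_int k * (2 * pi)"
    using cos_one_2pi_int by (auto simp: ac_simps)
  then have "\<alpha> = of_int k / of_int n" using assms(2) by (simp add: field_simps)
  then show False using assms(1) by simp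
qed

text \<open>Coefficients of exact order \<open>1 / |n|\<close>, the rate with which the hypothesis
  on \<open>f\<close> compares, so the sawtooth can serve as the majorant.\<close>

lemma fourier_sawtooth:
  assumes "n \<noteq> 0" shows "norm (fourier_coeff (\<lambda>x. x - 1/2) n) = 1 / (2 * pi * \<bar>of_int n\<bar>)"
proof -
  define w where "w = - 2 * pi * \<i> * of_int n"
  have w: "w \<noteq> 0" using assms by (simp add: w_def)
  have chr: "chr (- n) x = exp (w * of_real x)" for x
    by (simp add: chr_def cis_conv_exp w_def algebra_simps)
  \<comment> \<open>The antiderivative found by integrating by parts. As \<open>exp w = 1\<close>,
    the terms without the factor \<open>z - 1/2\<close> cancel between the end points and
    \<open>1 / w\<close> remains.\<close>
  let ?G = "\<lambda>z. (z - 1/2) * exp (w * z) / w - exp (w * z) / w\<^sup>2"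
  let ?g = "\<lambda>x::real. of_real (x - 1/2) * chr (- n) x"
  have "(?g has_integral (?G (of_real 1) - ?G (of_real 0))) {0..1}"
  proof (rule fundamental_theorem_of_calculus)
    fix x :: real
    have "(?G has_field_derivative ?g x) (at (of_real x))"
    proof -
      let ?z = "complex_of_real x" and ?e = "exp (w * complex_of_real x)"
      have "(?G has_field_derivative (?e + (?z - 1/2) * (?e * w)) / w - ?e * w / w\<^sup>2) (at ?z)"
      proof (intro DERIV_diff DERIV_cdivide)
        show e: "((\<lambda>z. exp (w * z)) has_field_derivative ?e * w) (at ?z)"
          by (auto intro!: derivative_eq_intros)
        show "((\<lambda>z. (z - 1/2) * exp (w * z)) has_field_derivative ?e + (?z - 1/2) * (?e * w)) (at ?z)"
          by (rule derivative_eq_intros e refl | simp)+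
      qed
      moreover have "(?e + (?z - 1/2) * (?e * w)) / w - ?e * w / w\<^sup>2 = (?z - 1/2) * ?e"
        using w by (simp add: add_divide_distrib power2_eq_square)
      ultimately show ?thesis by (simp add: chr)
    qed
    from has_vector_derivative_real_field[OF this]
    show "((\<lambda>x. ?G (of_real x)) has_vector_derivative ?g x) (at x within {0..1})" .
  qed simp
  moreover have "?G (of_real 1) - ?G (of_real 0) = 1 / w"
  proof -
    have "exp w = 1" using chr[of 1] chr_int[of "- n" 1] by simp
    then show ?thesis by (simp flip: add_divide_distrib)
  qed
  ultimately have 1: "(?g has_integral 1 / w) {0..1}" by simp
  have "integrable circle (\<lambda>x. x - 1/2)"
    by (rule circle.integrable_const_bound[where B = 1])
       (auto intro!: borel_measurable_lebesgue_onI simp: abs_le_iff)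
  then have "(?g has_integral fourier_coeff (\<lambda>x. x - 1/2) n) {0..<1}"
    unfolding fourier_coeff_chr by (intro has_integral_integral_lebesgue_on integrable_of_real_chr) auto
  moreover have "(?g has_integral J) {0..<1} \<longleftrightarrow> (?g has_integral J) {0..1}" for J
  proof (rule has_integral_spike_set_eq)
    show "negligible {x \<in> {0..<1} - {0..1}. ?g x \<noteq> 0}" by (rule negligible_subset[of "{}"]) auto
    show "negligible {x \<in> {0..1} - {0..<1}. ?g x \<noteq> 0}" by (rule negligible_subset[of "{1}"]) auto
  qed
  ultimately have "(?g has_integral fourier_coeff (\<lambda>x. x - 1/2) n) {0..1}" by blast
  then have "fourier_coeff (\<lambda>x. x - 1/2) n = 1 / w" using 1 has_integral_unique by blast
  then show ?thesis by (simp add: w_def norm_divide norm_mult)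
qed

text \<open>The Denjoy--Koksma inequality for the sawtooth.  Up to an error less than \<open>1 / q\<close> the
  orbit is the set of the points \<open>(r + u) / q\<close> with \<open>u = frac (q x)\<close> and \<open>0 \<le> r < q\<close>;
  only the points with \<open>r = 0\<close> or \<open>r = q - 1\<close> can be moved across \<open>0\<close>.\<close>

lemma sawtooth_rot_sum:
  fixes q :: nat and p :: int
  assumes q: "0 < q" and cop: "coprime p (int q)" and approx: "\<bar>real q * \<alpha> - of_int p\<bar> < 1 / real q"
  shows "\<bar>rot_sum \<alpha> q (\<lambda>x. x - 1/2) x\<bar> \<le> 4"
proof -
  define y where "y = (\<lambda>i. frac (x + real i * of_int p / real q))"
  define z where "z = (\<lambda>i. rotation (real i * \<alpha>) x)"
  \<comment> \<open>When the circle is cut into \<open>q\<close> arcs of length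
    \<open>1 / q\<close>, the point \<open>y i\<close> lies in the arc with index
    \<open>r i\<close>.\<close>
  define r where "r = (\<lambda>i. \<lfloor>real q * y i\<rfloor>)"
  let ?u = "frac (real q * x)"
  have y01: "0 \<le> y i" "y i < 1" for i by (auto simp: y_def frac_lt_1)
  have yr: "real q * y i = of_int (r i) + ?u" for i
  proof -
    have "real q * y i = real q * x + of_int (int i * p - int q * \<lfloor>x + real i * of_int p / real q\<rfloor>)"
      using q by (simp add: y_def frac_def field_simps)
    then have "frac (real q * y i) = ?u" by (simp only: frac_def floor_add_int of_int_add) simp
    then show ?thesis by (simp add: r_def frac_def)
  qed
  have r_in: "r i \<in> {0..<int q}" for i
  proof -
    have "0 \<le> real q * y i" "real q * y i < real q" using y01[of i] q by auto
    then show ?thesis unfolding r_def by (simp add: floor_less_iff)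
  qed
  \<comment> \<open>Equal indices force \<open>q\<close> to divide \<open>(i - j) * p\<close>, hence
    \<open>i - j\<close> by coprimality: each arc holds exactly one of the \<open>q\<close>
    points.\<close>
  have inj: "inj_on r {..<q}"
  proof (rule inj_onI)
    fix i j assume ij: "i \<in> {..<q}" "j \<in> {..<q}" "r i = r j"
    then have "real q * y i = real q * y j" using yr[of i] yr[of j] by simp
    then have "y i = y j" using q by simp
    then have "x + real i * of_int p / real q - (x + real j * of_int p / real q)
        = of_int (\<lfloor>x + real i * of_int p / real q\<rfloor> - \<lfloor>x + real j * of_int p / real q\<rfloor>)"
      unfolding y_def frac_def of_int_diff by linarith
    then obtain k where "x + real i * of_int p / real q - (x + real j * of_int p / real q) = of_int k"
      by blast
    then have "(real i * of_int p - real j * of_int p) / real q = of_int k"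
      by (simp add: diff_divide_distrib)
    then have "real i * of_int p - real j * of_int p = of_int k * real q" using q by (simp add: divide_eq_eq)
    then have "real_of_int ((int i - int j) * p) = real_of_int (int q * k)" by (simp add: algebra_simps)
    then have "int q dvd (int i - int j) * p" by (metis dvd_triv_left of_int_eq_iff)
    then have "int q dvd int i - int j" using cop by (simp add: coprime_dvd_mult_left_iff coprime_commute)
    moreover have "\<bar>int i - int j\<bar> < int q" using ij by auto
    ultimately have "int i - int j = 0" by (metis abs_of_nat dvd_imp_le_int not_less)
    then show "i = j" by simp
  qed
  have bij: "bij_betw r {..<q} {0..<int q}"
    unfolding bij_betw_def
  proof
    show "r ` {..<q} = {0..<int q}"
    proof (rule card_subset_eq)
      show "r ` {..<q} \<subseteq> {0..<int q}" using r_in by blast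
      show "card (r ` {..<q}) = card {0..<int q}" using card_image[OF inj] by simp
    qed simp
  qed (rule inj)
  have reindex: "(\<Sum>i<q. G (r i)) = (\<Sum>k\<in>{0..<int q}. G k)" for G :: "int \<Rightarrow> real"
    by (rule sum.reindex_bij_betw[OF bij])
  have sum_y: "(\<Sum>i<q. y i - 1/2) = ?u - 1/2"
  proof -
    have gauss: "(\<Sum>k\<in>{0..<int m}. real_of_int k) = real m * (real m - 1) / 2" for m
    proof (induction m)
      case (Suc m)
      have "{0..<int (Suc m)} = insert (int m) {0..<int m}" by auto
      then show ?case using Suc by (simp add: field_simps)
    qed simp
    have "y i - 1/2 = (of_int (r i) + ?u) / real q - 1/2" for i
      using yr[of i] q by (simp add: field_simps)
    then have "(\<Sum>i<q. y i - 1/2) = (\<Sum>k\<in>{0..<int q}. (of_int k + ?u) / real q - 1/2)"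
      using reindex[of "\<lambda>k. (of_int k + ?u) / real q - 1/2"] by simp
    also have "\<dots> = ((\<Sum>k\<in>{0..<int q}. real_of_int k) + real q * ?u) / real q - real q / 2"
      by (simp add: sum_subtractf sum.distrib flip: sum_divide_distrib)
    also have "\<dots> = ?u - 1/2" unfolding gauss using q by (simp add: field_simps)
    finally show ?thesis .
  qed
  have zy: "\<bar>z i - y i\<bar> \<le> 1 / real q + (if r i = 0 then 1 else 0) + (if r i = int q - 1 then 1 else 0)"
    if i: "i < q" for i
  proof -
    \<comment> \<open>The displacement of the \<open>i\<close>-th orbit point from its rational
      model; \<open>i < q\<close> keeps it below \<open>1 / q\<close> in modulus.\<close>
    define d where "d = real i * (\<alpha> - of_int p / real q)"
    have "d = real i / real q * (real q * \<alpha> - of_int p)" using q by (simp add: d_def right_diff_distrib)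
    then have "\<bar>d\<bar> = real i / real q * \<bar>real q * \<alpha> - of_int p\<bar>" by (simp add: abs_mult)
    also have "\<dots> \<le> 1 * \<bar>real q * \<alpha> - of_int p\<bar>" using i by (intro mult_right_mono) auto
    finally have d: "\<bar>d\<bar> < 1 / real q" using approx by simp
    have "z i = frac (y i + d + of_int \<lfloor>x + real i * of_int p / real q\<rfloor>)"
      using q by (simp add: z_def rotation_def y_def d_def frac_def algebra_simps)
    also have "\<dots> = frac (y i + d)" by (rule frac_add_int)
    finally have z: "z i = frac (y i + d)" .
    have q1: "1 / real q \<le> 1" using q by simp
    consider "y i + d < 0" | "0 \<le> y i + d" "y i + d < 1" | "1 \<le> y i + d" by linarith
    then show ?thesis
    proof cases
      case 1
      then have "y i < 1 / real q" using d by linarith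
      then have "real q * y i < 1" using q by (simp add: field_simps)
      then have "r i = 0" using r_in[of i] unfolding r_def by (simp add: floor_eq_iff)
      moreover have "z i = y i + d + 1"
        unfolding z using 1 d q1 y01[of i] by (subst frac_unique_iff) auto
      ultimately show ?thesis using d 1 by auto
    next
      case 2
      then show ?thesis using d frac_eq[of "y i + d"] by (auto simp: z)
    next
      case 3
      then have "1 - 1 / real q < y i" using d by linarith
      then have "real q - 1 < real q * y i" using q by (simp add: field_simps)
      moreover have "real q * y i < real q" using y01[of i] q by simp
      ultimately have "r i = int q - 1" unfolding r_def by (simp add: floor_eq_iff)
      moreover have "z i = y i + d - 1"
        unfolding z using 3 d q1 y01[of i] by (subst frac_unique_iff) auto
      ultimately show ?thesis using d 3 by auto
    qed
  qed
  have "\<bar>\<Sum>i<q. z i - y i\<bar> \<le> (\<Sum>i<q. \<bar>z i - y i\<bar>)" by (rule sum_abs)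
  also have "\<dots> \<le> (\<Sum>i<q. 1 / real q + (if r i = 0 then 1 else 0) + (if r i = int q - 1 then 1 else 0))"
    using zy by (intro sum_mono) auto
  also have "\<dots> = (\<Sum>k\<in>{0..<int q}. 1 / real q + (if k = 0 then 1 else 0) + (if k = int q - 1 then 1 else 0))"
    by (rule reindex)
  \<comment> \<open>The \<open>q\<close> errors \<open>1 / q\<close> sum to \<open>1\<close>, and
    each of the two indicator terms is nonzero for exactly one \<open>k\<close>.\<close>
  also have "\<dots> = 3" using q by (simp add: sum.distrib sum.delta)
  finally have "\<bar>\<Sum>i<q. z i - y i\<bar> \<le> 3" .
  moreover have "rot_sum \<alpha> q (\<lambda>x. x - 1/2) x = (\<Sum>i<q. z i - y i) + (\<Sum>i<q. y i - 1/2)"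
    by (simp add: rot_sum_def z_def flip: sum.distrib)
  moreover have "\<bar>?u - 1/2\<bar> \<le> 1" using frac_ge_0[of "real q * x"] frac_lt_1[of "real q * x"] by linarith
  ultimately show ?thesis using sum_y by linarith
qed

text \<open>Up to the factor \<open>4 * pi\<^sup>2\<close> the left side is a partial Bessel sum for
  the Birkhoff sum of the sawtooth, whose absolute value is at most \<open>4\<close>.\<close>

lemma chr_sum_weighted_bound:
  fixes q :: nat and p :: int
  assumes "0 < q" "coprime p (int q)" "\<bar>real q * \<alpha> - of_int p\<bar> < 1 / real q"
    and I: "finite I" "0 \<notin> I"
  shows "(\<Sum>n\<in>I. (norm (\<Sum>i<q. chr n (real i * \<alpha>)))\<^sup>2 / (of_int n)\<^sup>2) \<le> 64 * pi\<^sup>2"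
proof -
  let ?s = "\<lambda>x::real. x - 1/2"
  have s: "square_integrable circle ?s"
    by (rule sq_int_bounded[where B = 1]) (auto intro!: borel_measurable_lebesgue_onI simp: abs_le_iff)
  have "(\<Sum>n\<in>I. (norm (\<Sum>i<q. chr n (real i * \<alpha>)))\<^sup>2 / (of_int n)\<^sup>2)
      = 4 * pi\<^sup>2 * (\<Sum>n\<in>I. (norm (fourier_coeff (rot_sum \<alpha> q ?s) n))\<^sup>2)"
    unfolding sum_distrib_left
  proof (rule sum.cong)
    fix n assume "n \<in> I"
    then have "n \<noteq> 0" using I by auto
    then show "(norm (\<Sum>i<q. chr n (real i * \<alpha>)))\<^sup>2 / (of_int n)\<^sup>2
        = 4 * pi\<^sup>2 * (norm (fourier_coeff (rot_sum \<alpha> q ?s) n))\<^sup>2"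
      by (simp add: fourier_rot_sum[OF sq_intD(3)[OF s]] norm_mult fourier_sawtooth
          power_mult_distrib power_divide)
  qed simp
  also have "\<dots> \<le> 4 * pi\<^sup>2 * (LINT x|circle. (rot_sum \<alpha> q ?s x)\<^sup>2)"
    by (intro mult_left_mono bessel sq_int_rot_sum s I) auto
  also have "\<dots> \<le> 4 * pi\<^sup>2 * (LINT x|circle. 4\<^sup>2)"
  proof (intro mult_left_mono integral_mono)
    show "integrable circle (\<lambda>x. (rot_sum \<alpha> q ?s x)\<^sup>2)" by (intro sq_intD(2) sq_int_rot_sum s)
    show "(rot_sum \<alpha> q ?s x)\<^sup>2 \<le> 4\<^sup>2" for x
      using sawtooth_rot_sum[OF assms(1-3), of x] by (intro abs_le_square_iff[THEN iffD1]) simp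
  qed auto
  also have "\<dots> = 64 * pi\<^sup>2" using emeasure_circle by (simp add: measure_def)
  finally show ?thesis .
qed

text \<open>The finitely many low frequencies become small through the choice of \<open>q\<close>.
  The remaining ones are controlled by \<open>chr_sum_weighted_bound\<close>, uniformly in
  \<open>q\<close>, with a small factor from the decay of the coefficients. Each group is allotted
  \<open>e / 2\<close>.\<close>

lemma small_rot_sum:
  fixes h :: "real \<Rightarrow> real"
  assumes h: "square_integrable circle h" and h0: "fourier_coeff h 0 = 0"
    and small: "(\<lambda>n::int. norm (fourier_coeff h n)) \<in> o[sup at_bot at_top](\<lambda>n. 1 / \<bar>real_of_int n\<bar>)"
    and \<alpha>: "\<alpha> \<notin> \<rat>" and e: "0 < e"
  obtains q :: nat and p :: int
  where "\<bar>real q * \<alpha> - of_int p\<bar> < e" "real q * \<alpha> \<noteq> of_int p" "(LINT x|circle. (rot_sum \<alpha> q h x)\<^sup>2) \<le> e"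
proof -
  let ?c = "fourier_coeff h"
  \<comment> \<open>Chosen so that \<open>\<eta>\<^sup>2 * (64 * pi\<^sup>2) = e / 2\<close> in the
    tail estimate.\<close>
  define \<eta> where "\<eta> = sqrt (e / (128 * pi\<^sup>2))"
  have \<eta>: "0 < \<eta>" "\<eta>\<^sup>2 = e / (128 * pi\<^sup>2)" using e by (auto simp: \<eta>_def)
  have "eventually (\<lambda>n. norm (?c n) \<le> \<eta> * (1 / \<bar>real_of_int n\<bar>)) (sup at_bot at_top)"
    using landau_o.smallD[OF small \<eta>(1)] by simp
  then obtain N1 N2 where N12: "\<And>n. n \<le> N1 \<Longrightarrow> norm (?c n) \<le> \<eta> * (1 / \<bar>real_of_int n\<bar>)"
    "\<And>n. N2 \<le> n \<Longrightarrow> norm (?c n) \<le> \<eta> * (1 / \<bar>real_of_int n\<bar>)"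
    by (auto simp: eventually_sup eventually_at_bot_linorder eventually_at_top_linorder)
  \<comment> \<open>The frequencies left out by the two tail bounds. The frequency \<open>0\<close>
    is removed: its coefficient vanishes, and \<open>chr 0 \<alpha> - 1 = 0\<close> would occur as a
    divisor.\<close>
  define H where "H = {N1..N2} - {0}"
  define K where "K = (\<Sum>n\<in>H. (norm (?c n))\<^sup>2 * (2 * pi * of_int n)\<^sup>2 / (norm (chr n \<alpha> - 1))\<^sup>2)"
  have K: "0 \<le> K" unfolding K_def by (intro sum_nonneg) auto
  \<comment> \<open>The first entry of the maximum forces \<open>1 / N < e\<close>, the second makes
    the head at most \<open>K / N \<le> e / 2\<close>. Both are fixed before \<open>q\<close> is
    known.\<close>
  define N where "N = nat \<lceil>max (1 / e) (2 * K / e)\<rceil> + 1"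
  have N: "1 / e < real N" "2 * K / e \<le> real N" "0 < N" unfolding N_def by linarith+
  obtain p k where pk: "coprime p k" "0 < k" "k \<le> int N" "\<bar>of_int k * \<alpha> - of_int p\<bar> < 1 / N"
    using Dirichlet_approx_coprime[OF N(3), of \<alpha>] by blast
  define q where "q = nat k"
  have q: "0 < q" "coprime p (int q)" "\<bar>real q * \<alpha> - of_int p\<bar> < 1 / real N" "q \<le> N"
    using pk by (auto simp: q_def)
  \<comment> \<open>Dirichlet's theorem bounds the error by \<open>1 / N\<close>;
    \<open>q \<le> N\<close> turns this into the bound \<open>1 / q\<close> required by the
    Denjoy--Koksma estimate.\<close>
  have "1 / real N \<le> 1 / real q" using q N by (simp add: frac_le)
  then have q': "\<bar>real q * \<alpha> - of_int p\<bar> < 1 / real q" using q(3) by linarith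
  let ?D = "\<lambda>n. \<Sum>i<q. chr n (real i * \<alpha>)"
  have head: "(\<Sum>n\<in>H. (norm (?D n * ?c n))\<^sup>2) \<le> e / 2"
  proof -
    have "(norm (?D n * ?c n))\<^sup>2 \<le> (norm (?c n))\<^sup>2 * (2 * pi * of_int n)\<^sup>2 / (norm (chr n \<alpha> - 1))\<^sup>2 * (1 / real N)"
      if "n \<in> H" for n
    proof -
      have nz: "norm (chr n \<alpha> - 1) > 0" using chr_irrational[OF \<alpha>, of n] that by (auto simp: H_def)
      have "norm (?D n) * norm (chr n \<alpha> - 1) = norm (chr n (real q * \<alpha>) - 1)"
        by (simp flip: norm_mult add: chr_sum)
      also have "\<dots> \<le> 2 * pi * \<bar>of_int n\<bar> * \<bar>real q * \<alpha> - of_int p\<bar>"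
        using norm_chr_diff_1[of n "real q * \<alpha> - of_int p" p] by simp
      also have "\<dots> \<le> 2 * pi * \<bar>of_int n\<bar> * (1 / real N)"
        using q(3) by (intro mult_left_mono) auto
      finally have "norm (?D n) \<le> 2 * pi * \<bar>of_int n\<bar> * (1 / real N) / norm (chr n \<alpha> - 1)"
        by (simp only: pos_le_divide_eq[OF nz])
      then have "(norm (?D n))\<^sup>2 \<le> (2 * pi * \<bar>of_int n\<bar> * (1 / real N) / norm (chr n \<alpha> - 1))\<^sup>2"
        by (intro power_mono) auto
      also have "\<dots> = (2 * pi * of_int n)\<^sup>2 / (norm (chr n \<alpha> - 1))\<^sup>2 * (1 / real N)\<^sup>2"
        by (simp add: power_mult_distrib power_divide)
      also have "\<dots> \<le> (2 * pi * of_int n)\<^sup>2 / (norm (chr n \<alpha> - 1))\<^sup>2 * (1 / real N)"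
        using N(3) by (intro mult_left_mono) (auto simp: power2_eq_square field_simps)
      finally have "(norm (?D n))\<^sup>2 * (norm (?c n))\<^sup>2
          \<le> (2 * pi * of_int n)\<^sup>2 / (norm (chr n \<alpha> - 1))\<^sup>2 * (1 / real N) * (norm (?c n))\<^sup>2"
        by (intro mult_right_mono) auto
      then show ?thesis by (simp add: norm_mult power_mult_distrib mult_ac)
    qed
    then have "(\<Sum>n\<in>H. (norm (?D n * ?c n))\<^sup>2) \<le> K * (1 / real N)"
      unfolding K_def sum_distrib_right by (rule sum_mono)
    also have "\<dots> \<le> e / 2" using N e by (simp add: field_simps)
    finally show ?thesis .
  qed
  have tail: "(\<Sum>n\<in>I. (norm (?D n * ?c n))\<^sup>2) \<le> e / 2" if I: "finite I" "0 \<notin> I" "I \<inter> H = {}" for I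
  proof -
    have "(norm (?D n * ?c n))\<^sup>2 \<le> \<eta>\<^sup>2 * ((norm (?D n))\<^sup>2 / (of_int n)\<^sup>2)" if "n \<in> I" for n
    proof -
      have "n < N1 \<or> N2 < n" using I that by (auto simp: H_def)
      then have "norm (?c n) \<le> \<eta> * (1 / \<bar>real_of_int n\<bar>)" using N12 by auto
      then have "(norm (?c n))\<^sup>2 \<le> (\<eta> * (1 / \<bar>real_of_int n\<bar>))\<^sup>2" by (intro power_mono) auto
      then have "(norm (?D n))\<^sup>2 * (norm (?c n))\<^sup>2 \<le> (norm (?D n))\<^sup>2 * (\<eta> * (1 / \<bar>real_of_int n\<bar>))\<^sup>2"
        by (intro mult_left_mono) auto
      then show ?thesis by (simp add: norm_mult power_mult_distrib power_divide mult_ac)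
    qed
    then have "(\<Sum>n\<in>I. (norm (?D n * ?c n))\<^sup>2) \<le> \<eta>\<^sup>2 * (\<Sum>n\<in>I. (norm (?D n))\<^sup>2 / (of_int n)\<^sup>2)"
      unfolding sum_distrib_left by (rule sum_mono)
    also have "\<dots> \<le> \<eta>\<^sup>2 * (64 * pi\<^sup>2)"
      by (intro mult_left_mono chr_sum_weighted_bound[OF q(1,2) q' I(1,2)]) auto
    also have "\<dots> = e / 2" by (simp add: \<eta>(2))
    finally show ?thesis .
  qed
  have "(LINT x|circle. (rot_sum \<alpha> q h x)\<^sup>2) \<le> e"
  proof (rule parseval_le[OF sq_int_rot_sum[OF h]])
    fix I :: "int set" assume I: "finite I"
    have H: "finite H" by (simp add: H_def)
    have "(\<Sum>n\<in>I. (norm (fourier_coeff (rot_sum \<alpha> q h) n))\<^sup>2) = (\<Sum>n\<in>I. (norm (?D n * ?c n))\<^sup>2)"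
      by (simp add: fourier_rot_sum[OF sq_intD(3)[OF h]])
    also have "\<dots> \<le> (\<Sum>n\<in>H \<union> (I - H - {0}). (norm (?D n * ?c n))\<^sup>2)"
    proof -
      have "(\<Sum>n\<in>I. (norm (?D n * ?c n))\<^sup>2) = (\<Sum>n\<in>I - {0}. (norm (?D n * ?c n))\<^sup>2)"
        using I h0 by (intro sum.mono_neutral_right) auto
      also have "\<dots> \<le> (\<Sum>n\<in>H \<union> (I - H - {0}). (norm (?D n * ?c n))\<^sup>2)"
        using I H by (intro sum_mono2) auto
      finally show ?thesis .
    qed
    also have "\<dots> = (\<Sum>n\<in>H. (norm (?D n * ?c n))\<^sup>2) + (\<Sum>n\<in>I - H - {0}. (norm (?D n * ?c n))\<^sup>2)"
      using I H by (intro sum.union_disjoint) auto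
    also have "\<dots> \<le> e / 2 + e / 2" using I by (intro add_mono head tail) auto
    finally show "(\<Sum>n\<in>I. (norm (fourier_coeff (rot_sum \<alpha> q h) n))\<^sup>2) \<le> e" by simp
  qed
  moreover have "\<bar>real q * \<alpha> - of_int p\<bar> < e"
  proof -
    have "1 / real N < e" using N(1,3) e by (simp add: field_simps)
    then show ?thesis using q(3) by linarith
  qed
  moreover have "real q * \<alpha> \<noteq> of_int p"
  proof
    assume "real q * \<alpha> = of_int p"
    then have "\<alpha> = of_int p / real q" using q(1) by (simp add: field_simps)
    then show False using \<alpha> by simp
  qed
  ultimately show thesis using that by blast
qed

subsection \<open>Summing small transfer functions\<close>

text \<open>With the weight \<open>2 ^ k\<close> the integrals of \<open>w k\<close> are still
  summable. Pointwise, summability of the \<open>w k\<close> gives absolute convergence, and twice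
  their sum bounds the square of the absolute series.\<close>

lemma summable_L2:
  fixes u :: "nat \<Rightarrow> real \<Rightarrow> real"
  assumes u: "\<And>k. square_integrable circle (u k)" and b: "\<And>k. (LINT x|circle. (u k x)\<^sup>2) \<le> (1/4) ^ k"
  shows "AE x in circle. summable (\<lambda>k. \<bar>u k x\<bar>)"
    and "square_integrable circle (\<lambda>x. \<Sum>k. \<bar>u k x\<bar>)"
    and "square_integrable circle (\<lambda>x. \<Sum>k. u k x)"
proof -
  note [measurable] = sq_intD(1)[OF u]
  define w where "w = (\<lambda>k x. 2 ^ k * (u k x)\<^sup>2)"
  have w0: "0 \<le> w k x" for k x by (simp add: w_def)
  have wi: "integrable circle (w k)" for k
    unfolding w_def using sq_intD(2)[OF u] by simp
  have wI: "(LINT x|circle. w k x) \<le> (1/2) ^ k" for k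
  proof -
    have "(LINT x|circle. w k x) = 2 ^ k * (LINT x|circle. (u k x)\<^sup>2)" by (simp add: w_def)
    also have "\<dots> \<le> 2 ^ k * (1/4) ^ k" by (intro mult_left_mono b) auto
    also have "\<dots> = (1/2) ^ k" by (simp flip: power_mult_distrib)
    finally show ?thesis .
  qed
  have "(\<integral>\<^sup>+x. (\<Sum>k. ennreal (w k x)) \<partial>circle) = (\<Sum>k. \<integral>\<^sup>+x. ennreal (w k x) \<partial>circle)"
    by (rule nn_integral_suminf) (simp add: w_def)
  also have "\<dots> = (\<Sum>k. ennreal (LINT x|circle. w k x))"
    using wi w0 by (intro suminf_cong nn_integral_eq_integral) auto
  also have "\<dots> \<le> (\<Sum>k. ennreal ((1/2) ^ k))"
    by (intro suminf_le ennreal_leI wI) auto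
  also have "\<dots> < \<infinity>"
    by (subst suminf_ennreal2) (auto intro: summable_geometric)
  finally have "AE x in circle. (\<Sum>k. ennreal (w k x)) \<noteq> \<infinity>"
    by (intro nn_integral_PInf_AE) (auto simp: w_def)
  then have sw: "AE x in circle. summable (\<lambda>k. w k x)"
    by eventually_elim (use w0 in \<open>auto intro: summable_suminf_not_top\<close>)
  have "integrable circle (\<lambda>x. \<Sum>k. w k x)"
  proof (rule integrable_suminf)
    show "AE x in circle. summable (\<lambda>k. norm (w k x))" using sw w0 by simp
    show "summable (\<lambda>k. LINT x|circle. norm (w k x))"
    proof (rule summable_comparison_test')
      show "summable (\<lambda>k. (1/2 :: real) ^ k)" by (rule summable_geometric) simp
      show "norm (LINT x|circle. norm (w k x)) \<le> (1/2) ^ k" for k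
        using wI[of k] w0 by (simp add: integral_nonneg_AE)
    qed
  qed (rule wi)
  then have Wi: "integrable circle (\<lambda>x. 2 * (\<Sum>k. w k x))" by simp
  have su: "summable (\<lambda>k. \<bar>u k x\<bar>)" if "summable (\<lambda>k. w k x)" for x
  proof (rule summable_comparison_test')
    show "summable (\<lambda>k. (1/2) ^ k + w k x)"
      using that by (intro summable_add summable_geometric) auto
    show "norm \<bar>u k x\<bar> \<le> (1/2) ^ k + w k x" for k
    \<comment> \<open>A term above \<open>(1/2) ^ k\<close> is at most \<open>2 ^ k\<close> times
      its own square.\<close>
    proof (cases "\<bar>u k x\<bar> \<le> (1/2) ^ k")
      case False
      then have "2 ^ k * (1/2) ^ k \<le> 2 ^ k * \<bar>u k x\<bar>" by (intro mult_left_mono) auto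
      then have "1 \<le> 2 ^ k * \<bar>u k x\<bar>" by (simp flip: power_mult_distrib)
      then have "1 * \<bar>u k x\<bar> \<le> 2 ^ k * \<bar>u k x\<bar> * \<bar>u k x\<bar>" by (intro mult_right_mono) auto
      then have "\<bar>u k x\<bar> \<le> w k x" by (simp add: w_def power2_eq_square mult.assoc)
      then show ?thesis by (simp add: add_increasing)
    qed (use w0[of k x] in simp)
  qed
  show s: "AE x in circle. summable (\<lambda>k. \<bar>u k x\<bar>)" using sw by eventually_elim (rule su)
  text \<open>Iterating \<open>(a + b)\<^sup>2 \<le> 2 a\<^sup>2 + 2 b\<^sup>2\<close>.\<close>
  have fin: "(\<Sum>j<n. \<bar>v j\<bar>)\<^sup>2 \<le> 2 * (\<Sum>j<n. 2 ^ j * (v j)\<^sup>2)" for n and v :: "nat \<Rightarrow> real"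
  proof (induction n arbitrary: v)
    case (Suc n)
    have "(\<Sum>j<Suc n. \<bar>v j\<bar>)\<^sup>2 = (\<bar>v 0\<bar> + (\<Sum>j<n. \<bar>v (Suc j)\<bar>))\<^sup>2"
      by (simp only: sum.lessThan_Suc_shift)
    also have "\<dots> \<le> 2 * (v 0)\<^sup>2 + 2 * (\<Sum>j<n. \<bar>v (Suc j)\<bar>)\<^sup>2"
      using sum_squares_bound[of "\<bar>v 0\<bar>" "\<Sum>j<n. \<bar>v (Suc j)\<bar>"] by (simp add: power2_sum)
    also have "\<dots> \<le> 2 * (v 0)\<^sup>2 + 2 * (2 * (\<Sum>j<n. 2 ^ j * (v (Suc j))\<^sup>2))"
      using Suc.IH[of "\<lambda>j. v (Suc j)"] by simp
    also have "\<dots> = 2 * (\<Sum>j<Suc n. 2 ^ j * (v j)\<^sup>2)"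
      by (simp add: sum.lessThan_Suc_shift sum_distrib_left mult_ac del: sum.lessThan_Suc)
    finally show ?case .
  qed simp
  have bound: "(\<Sum>k. \<bar>u k x\<bar>)\<^sup>2 \<le> 2 * (\<Sum>k. w k x)" if x: "summable (\<lambda>k. w k x)" for x
  proof -
    have "(\<Sum>k. \<bar>u k x\<bar>) \<le> sqrt (2 * (\<Sum>k. w k x))"
    proof (rule suminf_le_const[OF su[OF x]])
      fix n
      have "(\<Sum>j<n. \<bar>u j x\<bar>)\<^sup>2 \<le> 2 * (\<Sum>j<n. w j x)" using fin[of "\<lambda>j. u j x" n] by (simp add: w_def)
      also have "\<dots> \<le> 2 * (\<Sum>k. w k x)" using sum_le_suminf[OF x, of "{..<n}"] w0 by simp
      finally show "(\<Sum>j<n. \<bar>u j x\<bar>) \<le> sqrt (2 * (\<Sum>k. w k x))" by (rule real_le_rsqrt)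
    qed
    moreover have "0 \<le> (\<Sum>k. \<bar>u k x\<bar>)" by (rule suminf_nonneg[OF su[OF x]]) simp
    moreover have "0 \<le> (\<Sum>k. w k x)" by (rule suminf_nonneg[OF x w0])
    ultimately show ?thesis using power_mono[of _ "sqrt (2 * (\<Sum>k. w k x))" 2] by simp
  qed
  show U: "square_integrable circle (\<lambda>x. \<Sum>k. \<bar>u k x\<bar>)"
    unfolding square_integrable_def
  proof
    show "integrable circle (\<lambda>x. (\<Sum>k. \<bar>u k x\<bar>)\<^sup>2)"
      using Wi
    proof (rule Bochner_Integration.integrable_bound)
      show "AE x in circle. norm ((\<Sum>k. \<bar>u k x\<bar>)\<^sup>2) \<le> norm (2 * (\<Sum>k. w k x))"
        using sw
      proof eventually_elim
        case (elim x)
        then show ?case using bound[OF elim] suminf_nonneg[OF elim w0] by simp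
      qed
    qed measurable
  qed measurable
  show "square_integrable circle (\<lambda>x. \<Sum>k. u k x)"
    by (rule sq_int_bound[OF _ U])
       (use s in \<open>auto elim!: eventually_mono intro: order_trans[OF summable_rabs abs_ge_self]\<close>)
qed

lemma rot_sum_0 [simp]: "rot_sum \<alpha> 0 h x = 0"
  by (simp add: rot_sum_def)

lemma rot_sum_add: "rot_sum \<alpha> (m + n) h x = rot_sum \<alpha> m h x + rot_sum \<alpha> n h (rotation (real m * \<alpha>) x)"
proof -
  have "rot_sum \<alpha> (m + n) h x = rot_sum \<alpha> m h x + (\<Sum>i<n. h (rotation (real (m + i) * \<alpha>) x))"
    unfolding rot_sum_def by (induction n) simp_all
  then show ?thesis by (simp add: rot_sum_def rotation_rotation distrib_right)
qed

text \<open>A limit of the coboundary equations for \<open>\<beta> = M\<^sub>K \<alpha>\<close>, whose solutions are Birkhoff sums.\<close>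

lemma cocycle_translation:
  fixes f :: "real \<Rightarrow> real"
  assumes f: "square_integrable circle f"
    and small: "\<And>k. (LINT x|circle. (rot_sum \<alpha> (q k) (\<lambda>x. f x - c) x)\<^sup>2) \<le> (1/4) ^ k"
    and lim: "(\<lambda>K. \<Sum>k<K. if k \<in> A then real (q k) * \<alpha> - of_int (p k) else 0) \<longlonglongrightarrow> \<beta>"
  obtains g where "square_integrable circle g"
    "AE x in circle. f (rotation \<beta> x) - f x = g (rotation \<alpha> x) - g x"
proof -
  define f0 where "f0 = (\<lambda>x. f x - c)"
  have f0: "square_integrable circle f0"
    unfolding f0_def by (intro sq_int_diff f sq_int_bounded[where B = "\<bar>c\<bar>"]) auto
  \<comment> \<open>The number of rotations used by the selected blocks before \<open>K\<close>.
    Block \<open>k\<close> starts at time \<open>M k\<close>; its Birkhoff sum is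
    \<open>u k\<close>, and the blocks concatenate to the sum of length \<open>M K\<close>.\<close>
  define M where "M = (\<lambda>K. \<Sum>k<K. if k \<in> A then q k else 0)"
  define u where "u = (\<lambda>k x. if k \<in> A then rot_sum \<alpha> (q k) f0 (rotation (real (M k) * \<alpha>) x) else 0)"
  have uk: "square_integrable circle (u k)" for k
  proof (cases "k \<in> A")
    case True
    then have "u k = (\<lambda>x. rot_sum \<alpha> (q k) f0 (rotation (real (M k) * \<alpha>) x))" by (simp add: u_def fun_eq_iff)
    then show ?thesis by (simp only: sq_int_rotation[OF sq_int_rot_sum[OF f0]])
  next
    case False
    then have "u k = (\<lambda>x. 0)" by (simp add: u_def fun_eq_iff)
    then show ?thesis using sq_int_bounded[of "\<lambda>x. 0" 0] by simp
  qed
  have uI: "(LINT x|circle. (u k x)\<^sup>2) \<le> (1/4) ^ k" for k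
  proof (cases "k \<in> A")
    case True
    have "(LINT x|circle. (u k x)\<^sup>2) = (LINT x|circle. (rot_sum \<alpha> (q k) f0 x)\<^sup>2)"
      unfolding u_def using True sq_intD(1)[OF sq_int_rot_sum[OF f0]]
      by (simp add: integral_rotation[of "\<lambda>x. (rot_sum \<alpha> (q k) f0 x)\<^sup>2"])
    then show ?thesis using small[of k] by (simp add: f0_def)
  qed (simp add: u_def)
  have G: "(\<Sum>k<K. u k x) = rot_sum \<alpha> (M K) f0 x" for K x
  proof (induction K)
    case 0
    show ?case by (simp add: M_def rot_sum_def)
  next
    case (Suc K)
    have "M (Suc K) = M K + (if K \<in> A then q K else 0)" by (simp add: M_def)
    then show ?case using Suc by (simp add: rot_sum_add u_def)
  qed
  note L2 = summable_L2[of u, OF uk uI]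
  define g where "g = (\<lambda>x. \<Sum>k. u k x)"
  have g: "square_integrable circle g" unfolding g_def by (rule L2)
  have lim_coeff: "(\<lambda>K. fourier_coeff (rot_sum \<alpha> (M K) f0) n) \<longlonglongrightarrow> fourier_coeff g n" for n
    unfolding fourier_coeff_chr
  proof (rule integral_dominated_convergence[where w = "\<lambda>x. \<Sum>k. \<bar>u k x\<bar>"])
    show "integrable circle (\<lambda>x. \<Sum>k. \<bar>u k x\<bar>)" by (rule sq_intD(3)[OF L2(2)])
    show "(\<lambda>x. of_real (g x) * chr (- n) x) \<in> borel_measurable circle"
      by (intro borel_measurable_integrable integrable_of_real_chr sq_intD(3)[OF g])
    show "(\<lambda>x. of_real (rot_sum \<alpha> (M K) f0 x) * chr (- n) x) \<in> borel_measurable circle" for K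
      by (intro borel_measurable_integrable integrable_of_real_chr sq_intD(3) sq_int_rot_sum f0)
    show "AE x in circle. (\<lambda>K. of_real (rot_sum \<alpha> (M K) f0 x) * chr (- n) x) \<longlonglongrightarrow> of_real (g x) * chr (- n) x"
      using L2(1)
    proof eventually_elim
      case (elim x)
      then have "(\<lambda>K. \<Sum>k<K. u k x) \<longlonglongrightarrow> g x"
        unfolding g_def by (rule summable_LIMSEQ[OF summable_rabs_cancel])
      then show ?case unfolding G by (intro tendsto_intros)
    qed
    show "AE x in circle. norm (of_real (rot_sum \<alpha> (M K) f0 x) * chr (- n) x) \<le> (\<Sum>k. \<bar>u k x\<bar>)" for K
      using L2(1)
    proof eventually_elim
      case (elim x)
      have "\<bar>\<Sum>k<K. u k x\<bar> \<le> (\<Sum>k<K. \<bar>u k x\<bar>)" by (rule sum_abs)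
      also have "\<dots> \<le> (\<Sum>k. \<bar>u k x\<bar>)" by (rule sum_le_suminf[OF elim]) auto
      finally show ?case unfolding G by (simp add: norm_mult)
    qed
  qed
  \<comment> \<open>The coboundary equation in Fourier coefficients. At \<open>n = 0\<close> both
    sides vanish; at other frequencies the subtracted constant \<open>c\<close> is
    invisible.\<close>
  have coeff: "(chr n \<alpha> - 1) * fourier_coeff g n = (chr n \<beta> - 1) * fourier_coeff f n" for n
  proof (cases "n = 0")
    case False
    define S where "S = (\<lambda>K. \<Sum>k<K. if k \<in> A then real (q k) * \<alpha> - of_int (p k) else 0)"
    \<comment> \<open>Characters ignore the integers \<open>p k\<close>, so
      \<open>real (M K) * \<alpha>\<close> may be replaced by the convergent sums
      \<open>S K\<close>.\<close>
    have chrM: "chr n (real (M K) * \<alpha>) = chr n (S K)" for K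
    proof -
      have "real (M K) * \<alpha> = S K + of_int (\<Sum>k<K. if k \<in> A then p k else 0)"
        unfolding M_def S_def by (induction K) (auto simp: algebra_simps)
      then show ?thesis by (simp only: chr_plus chr_int mult_1_right)
    qed
    have f0n: "fourier_coeff f0 n = fourier_coeff f n"
      unfolding f0_def using False
      by (subst fourier_diff) (auto simp: sq_intD(3)[OF f] fourier_const)
    have "(\<lambda>K. (chr n \<alpha> - 1) * fourier_coeff (rot_sum \<alpha> (M K) f0) n) \<longlonglongrightarrow> (chr n \<alpha> - 1) * fourier_coeff g n"
      by (intro tendsto_intros lim_coeff)
    moreover have "(chr n \<alpha> - 1) * fourier_coeff (rot_sum \<alpha> (M K) f0) n = (chr n (S K) - 1) * fourier_coeff f n" for K
    proof -
      have "(chr n \<alpha> - 1) * fourier_coeff (rot_sum \<alpha> (M K) f0) n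
          = (\<Sum>i<M K. chr n (real i * \<alpha>)) * (chr n \<alpha> - 1) * fourier_coeff f n"
        by (simp add: fourier_rot_sum[OF sq_intD(3)[OF f0]] f0n mult.assoc mult.left_commute)
      then show ?thesis by (simp only: chr_sum chrM)
    qed
    moreover have "(\<lambda>K. (chr n (S K) - 1) * fourier_coeff f n) \<longlonglongrightarrow> (chr n \<beta> - 1) * fourier_coeff f n"
    proof -
      have "isCont (chr n) \<beta>" using continuous_chr[of UNIV n] by (simp add: continuous_on_eq_continuous_at)
      then have "(\<lambda>K. chr n (S K)) \<longlonglongrightarrow> chr n \<beta>"
        using lim unfolding S_def by (rule isCont_tendsto_compose)
      then show ?thesis by (intro tendsto_intros)
    qed
    ultimately show ?thesis by (simp only: LIMSEQ_unique)
  qed simp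
  have "AE x in circle. (f (rotation \<beta> x) - f x) - (g (rotation \<alpha> x) - g x) = 0"
  proof (rule fourier_unique)
    show "square_integrable circle (\<lambda>x. (f (rotation \<beta> x) - f x) - (g (rotation \<alpha> x) - g x))"
      by (rule sq_int_diff[OF sq_int_diff[OF sq_int_rotation[OF f] f] sq_int_diff[OF sq_int_rotation[OF g] g]])
    fix n
    have i: "integrable circle f" "integrable circle g" using f g by (auto intro: sq_intD(3))
    have "fourier_coeff (\<lambda>x. (f (rotation \<beta> x) - f x) - (g (rotation \<alpha> x) - g x)) n
        = (chr n \<beta> - 1) * fourier_coeff f n - (chr n \<alpha> - 1) * fourier_coeff g n"
      by (simp add: fourier_diff integrable_rotation i fourier_rotation left_diff_distrib)
    then show "fourier_coeff (\<lambda>x. (f (rotation \<beta> x) - f x) - (g (rotation \<alpha> x) - g x)) n = 0"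
      by (simp add: coeff)
  qed
  then have "AE x in circle. f (rotation \<beta> x) - f x = g (rotation \<alpha> x) - g x" by simp
  with g show thesis by (rule that)
qed

subsection \<open>Uncountably many subsums\<close>

text \<open>The factors \<open>s\<close> cover indicator functions of sets as well as differences of
  two of them.\<close>

lemma subsum_bound:
  fixes d :: "nat \<Rightarrow> real"
  assumes d: "\<And>j. \<bar>d j\<bar> \<le> D * (1/4) ^ j" and s: "\<And>j. \<bar>s j\<bar> \<le> 1"
  shows "summable (\<lambda>j. s j * d j)" "\<bar>\<Sum>j. s j * d j\<bar> \<le> 4/3 * D"
proof -
  have b: "norm (s j * d j) \<le> D * (1/4) ^ j" for j
    using mult_mono[OF s[of j] d[of j]] by (simp add: abs_mult)
  have g: "(\<lambda>j. D * (1/4) ^ j) sums (D * (1 / (1 - 1/4)))" by (intro sums_mult geometric_sums) simp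
  show "summable (\<lambda>j. s j * d j)"
    using sums_summable[OF g] b by (rule summable_comparison_test')
  have "norm (\<Sum>j. s j * d j) \<le> (\<Sum>j. D * (1/4) ^ j)"
    using b sums_summable[OF g] by (rule norm_suminf_le)
  then show "\<bar>\<Sum>j. s j * d j\<bar> \<le> 4/3 * D" using sums_unique[OF g] by simp
qed

text \<open>If \<open>A\<close> and \<open>B\<close> first differ at \<open>m\<close>, the later
  terms add up to at most a third of \<open>|d m|\<close>, so the difference of the sums is not
  \<open>0\<close>. Smallness of \<open>d 0\<close> keeps it below \<open>1\<close> in modulus, so
  it is no other integer either.\<close>

lemma inj_frac_subsums:
  fixes d :: "nat \<Rightarrow> real"
  assumes d0: "\<And>k. d k \<noteq> 0" and dS: "\<And>k. \<bar>d (Suc k)\<bar> \<le> \<bar>d k\<bar> / 4" and d8: "\<bar>d 0\<bar> < 1/8"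
  shows "inj (\<lambda>A. frac (\<Sum>k. indicator A k * d k))"
proof (rule injI, rule ccontr)
  fix A B assume eq: "frac (\<Sum>k. indicator A k * d k) = frac (\<Sum>k. indicator B k * d k)" and "A \<noteq> B"
  have dec: "\<bar>d (k + j)\<bar> \<le> \<bar>d k\<bar> * (1/4) ^ j" for j k
  proof (induction j)
    case (Suc j)
    then show ?case using dS[of "k + j"] by simp
  qed simp
  define s where "s = (\<lambda>k. indicator A k - indicator B k :: real)"
  have s1: "\<bar>s k\<bar> \<le> 1" for k by (simp add: s_def indicator_def)
  have summ: "summable (\<lambda>k. indicator C k * d k)" for C :: "nat set"
    using dec[of 0] by (intro subsum_bound[where D = "\<bar>d 0\<bar>"]) (auto simp: indicator_def)
  have diff: "(\<Sum>k. indicator A k * d k) - (\<Sum>k. indicator B k * d k) = (\<Sum>k. s k * d k)"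
    unfolding s_def left_diff_distrib by (rule suminf_diff[OF summ summ])
  have "\<bar>\<Sum>k. s k * d k\<bar> \<le> 4/3 * \<bar>d 0\<bar>"
    using dec[of 0] by (intro subsum_bound s1) auto
  then have lt1: "\<bar>\<Sum>k. s k * d k\<bar> < 1" using d8 by linarith
  obtain m where m: "s m \<noteq> 0" "\<And>k. k < m \<Longrightarrow> s k = 0"
  proof -
    have "\<exists>k. s k \<noteq> 0" using \<open>A \<noteq> B\<close> by (auto simp: s_def indicator_def split: if_splits)
    then show thesis using that exists_least_iff[of "\<lambda>k. s k \<noteq> 0"] by blast
  qed
  have sd: "summable (\<lambda>k. s k * d k)"
    using dec[of 0] by (intro subsum_bound(1)[where D = "\<bar>d 0\<bar>"] s1) auto
  have "(\<Sum>k. s k * d k) = (\<Sum>k. s (k + Suc m) * d (k + Suc m)) + (\<Sum>k<Suc m. s k * d k)"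
    by (rule suminf_split_initial_segment[OF sd])
  also have "(\<Sum>k<Suc m. s k * d k) = s m * d m" using m(2) by simp
  finally have split: "(\<Sum>k. s k * d k) = (\<Sum>k. s (k + Suc m) * d (k + Suc m)) + s m * d m" .
  have "\<bar>\<Sum>k. s (k + Suc m) * d (k + Suc m)\<bar> \<le> 4/3 * \<bar>d (Suc m)\<bar>"
    using dec[of "Suc m"] by (intro subsum_bound s1) (simp add: add.commute)
  also have "\<dots> \<le> \<bar>d m\<bar> / 3" using dS[of m] by simp
  also have "\<dots> < \<bar>d m\<bar>" using d0[of m] by simp
  also have "\<bar>d m\<bar> = \<bar>s m * d m\<bar>" using m(1) by (auto simp: s_def indicator_def split: if_splits)
  finally have "(\<Sum>k. s k * d k) \<noteq> 0" unfolding split by linarith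
  moreover have "(\<Sum>k. s k * d k) \<in> \<int>"
  proof -
    have "(\<Sum>k. s k * d k) = of_int (\<lfloor>\<Sum>k. indicator A k * d k\<rfloor> - \<lfloor>\<Sum>k. indicator B k * d k\<rfloor>)"
      using eq diff unfolding frac_def of_int_diff by linarith
    then show ?thesis by (metis Ints_of_int)
  qed
  ultimately show False using lt1 Ints_nonzero_abs_ge1 by fastforce
qed

lemma uncountable_nat_sets: "uncountable (UNIV :: nat set set)"
proof
  assume "countable (UNIV :: nat set set)"
  then have "range (from_nat_into (UNIV :: nat set set)) = UNIV"
    by (intro range_from_nat_into) auto
  then show False using Cantors_theorem[of "UNIV :: nat set"] by auto
qed

lemma uncountable_cocycle_translations:
  fixes f :: "real \<Rightarrow> real"
  assumes f: "square_integrable circle f"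
    and small: "(\<lambda>n::int. norm (fourier_coeff f n)) \<in> o[sup at_bot at_top](\<lambda>n. 1 / \<bar>real_of_int n\<bar>)"
    and \<alpha>: "\<alpha> \<notin> \<rat>"
  shows "uncountable {\<beta> \<in> {0..<1}. \<exists>g. square_integrable circle g \<and>
             (AE x in circle. f (rotation \<beta> x) - f x = g (rotation \<alpha> x) - g x)}" (is "uncountable ?B")
proof -
  define c where "c = (LINT x|circle. f x)"
  define f0 where "f0 = (\<lambda>x. f x - c)"
  have f0: "square_integrable circle f0"
    unfolding f0_def by (intro sq_int_diff f sq_int_bounded[where B = "\<bar>c\<bar>"]) auto
  have coeff: "fourier_coeff f0 n = (if n = 0 then 0 else fourier_coeff f n)" for n
  proof -
    have "fourier_coeff f 0 = of_real c" unfolding fourier_coeff_chr c_def by simp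
    then show ?thesis unfolding f0_def
      by (subst fourier_diff) (auto simp: sq_intD(3)[OF f] fourier_const)
  qed
  \<comment> \<open>Removing the mean alters only the coefficient at \<open>0\<close>, which the
    limit at both infinities does not see.\<close>
  have "eventually (\<lambda>n::int. n \<noteq> 0) (sup at_bot at_top)"
    by (auto simp: eventually_sup intro: eventually_at_bot_not_equal eventually_at_top_not_equal)
  then have "eventually (\<lambda>n. norm (fourier_coeff f0 n) = norm (fourier_coeff f n)) (sup at_bot at_top)"
    by eventually_elim (simp add: coeff)
  from landau_o.small.in_cong[OF this] small
  have small0: "(\<lambda>n::int. norm (fourier_coeff f0 n)) \<in> o[sup at_bot at_top](\<lambda>n. 1 / \<bar>real_of_int n\<bar>)"
    by blast
  let ?d = "\<lambda>x :: nat \<times> int. real (fst x) * \<alpha> - of_int (snd x)"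
  have ex: "\<exists>x. ?d x \<noteq> 0 \<and> \<bar>?d x\<bar> < e \<and> (LINT t|circle. (rot_sum \<alpha> (fst x) f0 t)\<^sup>2) \<le> e" if "0 < e" for e
  proof -
    have "fourier_coeff f0 0 = 0" by (simp add: coeff)
    then obtain q p where "\<bar>real q * \<alpha> - of_int p\<bar> < e" "real q * \<alpha> \<noteq> of_int p"
        "(LINT x|circle. (rot_sum \<alpha> q f0 x)\<^sup>2) \<le> e"
      by (rule small_rot_sum[OF f0 _ small0 \<alpha> \<open>0 < e\<close>])
    then show ?thesis by (intro exI[of _ "(q, p)"]) auto
  qed
  obtain x where x: "\<And>k. ?d (x k) \<noteq> 0 \<and> \<bar>?d (x k)\<bar> < 1/8 \<and> (LINT t|circle. (rot_sum \<alpha> (fst (x k)) f0 t)\<^sup>2) \<le> (1/4) ^ k"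
      "\<And>k. \<bar>?d (x (Suc k))\<bar> \<le> \<bar>?d (x k)\<bar> / 4"
  proof (rule dependent_nat_choice[where
        P = "\<lambda>k x. ?d x \<noteq> 0 \<and> \<bar>?d x\<bar> < 1/8 \<and> (LINT t|circle. (rot_sum \<alpha> (fst x) f0 t)\<^sup>2) \<le> (1/4) ^ k"
        and Q = "\<lambda>k x y. \<bar>?d y\<bar> \<le> \<bar>?d x\<bar> / 4", THEN exE])
    show "\<exists>x. ?d x \<noteq> 0 \<and> \<bar>?d x\<bar> < 1/8 \<and> (LINT t|circle. (rot_sum \<alpha> (fst x) f0 t)\<^sup>2) \<le> (1/4) ^ 0"
      using ex[of "1/8"] by fastforce
  next
    fix x and k :: nat assume x: "?d x \<noteq> 0 \<and> \<bar>?d x\<bar> < 1/8 \<and> (LINT t|circle. (rot_sum \<alpha> (fst x) f0 t)\<^sup>2) \<le> (1/4) ^ k"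
    \<comment> \<open>The tolerance serves twice: \<open>(1/4) ^ Suc k\<close> for the L^2 bound and
      a quarter of the previous displacement for the decay.\<close>
    then have "0 < min ((1/4) ^ Suc k) (\<bar>?d x\<bar> / 4)" by simp
    from ex[OF this] obtain y where "?d y \<noteq> 0" "\<bar>?d y\<bar> < min ((1/4) ^ Suc k) (\<bar>?d x\<bar> / 4)"
      "(LINT t|circle. (rot_sum \<alpha> (fst y) f0 t)\<^sup>2) \<le> min ((1/4) ^ Suc k) (\<bar>?d x\<bar> / 4)" by blast
    with x show "\<exists>y. (?d y \<noteq> 0 \<and> \<bar>?d y\<bar> < 1/8 \<and> (LINT t|circle. (rot_sum \<alpha> (fst y) f0 t)\<^sup>2) \<le> (1/4) ^ Suc k)
        \<and> \<bar>?d y\<bar> \<le> \<bar>?d x\<bar> / 4"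
      by (intro exI[of _ y]) auto
  qed (use that in blast)
  define d where "d = (\<lambda>k. ?d (x k))"
  have d: "\<And>k. d k \<noteq> 0" "\<And>k. \<bar>d (Suc k)\<bar> \<le> \<bar>d k\<bar> / 4" "\<bar>d 0\<bar> < 1/8"
    using x by (auto simp: d_def)
  let ?\<beta> = "\<lambda>A. frac (\<Sum>k. indicator A k * d k)"
  have "?\<beta> A \<in> ?B" for A
  proof -
    have dec: "\<bar>d j\<bar> \<le> \<bar>d 0\<bar> * (1/4) ^ j" for j
    proof (induction j)
      case (Suc j)
      then show ?case using d(2)[of j] by simp
    qed simp
    have "summable (\<lambda>k. indicator A k * d k)"
      using dec by (intro subsum_bound(1)[where D = "\<bar>d 0\<bar>"]) (auto simp: indicator_def)
    then have "(\<lambda>K. \<Sum>k<K. indicator A k * d k) \<longlonglongrightarrow> (\<Sum>k. indicator A k * d k)" by (rule summable_LIMSEQ)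
    moreover have "indicator A k * d k = (if k \<in> A then real (fst (x k)) * \<alpha> - of_int (snd (x k)) else 0)" for k
      by (simp add: d_def)
    ultimately have "(\<lambda>K. \<Sum>k<K. if k \<in> A then real (fst (x k)) * \<alpha> - of_int (snd (x k)) else 0)
        \<longlonglongrightarrow> (\<Sum>k. indicator A k * d k)" by simp
    then obtain g where "square_integrable circle g"
        "AE t in circle. f (rotation (\<Sum>k. indicator A k * d k) t) - f t = g (rotation \<alpha> t) - g t"
      using cocycle_translation[OF f, of \<alpha> "\<lambda>k. fst (x k)" c A "\<lambda>k. snd (x k)"] x(1)
      unfolding f0_def by blast
    then show ?thesis by (auto simp: frac_lt_1)
  qed
  then have "range ?\<beta> \<subseteq> ?B" by blast
  moreover have "uncountable (range ?\<beta>)"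
    using uncountable_nat_sets inj_frac_subsums[OF d] countable_image_inj_on by blast
  ultimately show ?thesis using countable_subset by blast
qed

subsection \<open>Divergence of Birkhoff sums\<close>

text \<open>Where the series converges the terms tend to \<open>0\<close>, but their truncated integrals over
  the invariant set of convergence do not depend on \<open>n\<close>.\<close>

lemma AE_not_summable_orbit:
  fixes f :: "real \<Rightarrow> real"
  assumes [measurable]: "f \<in> borel_measurable circle" and pos: "\<And>x. x \<in> {0..<1} \<Longrightarrow> 0 < f x"
  shows "AE x in circle. \<not> summable (\<lambda>i. f (rotation (real i * \<alpha>) x))"
proof -
  let ?P = "\<lambda>x. summable (\<lambda>i. f (rotation (real i * \<alpha>) x))"
  have inv: "?P (rotation (real n * \<alpha>) x) \<longleftrightarrow> ?P x" for n x
  proof -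
    have "?P (rotation (real n * \<alpha>) x) \<longleftrightarrow> summable (\<lambda>i. f (rotation (real (i + n) * \<alpha>) x))"
      by (simp add: rotation_rotation distrib_right add.commute)
    also have "\<dots> \<longleftrightarrow> ?P x" by (rule summable_iff_shift)
    finally show ?thesis .
  qed
  \<comment> \<open>Truncation at \<open>1\<close> gives a bounded function, so that dominated
    convergence applies to a merely measurable \<open>f\<close>.\<close>
  define \<phi> where "\<phi> = (\<lambda>x. if ?P x then min (f x) 1 else 0)"
  have [measurable]: "Measurable.pred circle ?P"
    unfolding summable_iff_convergent Cauchy_convergent_iff[symmetric] pred_def
    by (rule sets_Collect_Cauchy) measurable
  have [measurable]: "\<phi> \<in> borel_measurable circle" unfolding \<phi>_def by measurable
  have bnd: "0 \<le> \<phi> x" "\<phi> x \<le> 1" if "x \<in> {0..<1}" for x using pos[OF that] by (auto simp: \<phi>_def)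
  have \<phi>_int: "integrable circle \<phi>"
    by (rule circle.integrable_const_bound[where B = 1]) (use bnd in auto)
  have "(\<lambda>n. LINT x|circle. \<phi> (rotation (real n * \<alpha>) x)) \<longlonglongrightarrow> (LINT x|circle. 0)"
  proof (rule integral_dominated_convergence[where w = "\<lambda>_. 1"])
    show "AE x in circle. (\<lambda>n. \<phi> (rotation (real n * \<alpha>) x)) \<longlonglongrightarrow> 0"
    proof (rule AE_I2)
      fix x
      show "(\<lambda>n. \<phi> (rotation (real n * \<alpha>) x)) \<longlonglongrightarrow> 0"
      proof (cases "?P x")
        case True
        then have "(\<lambda>n. min (f (rotation (real n * \<alpha>) x)) 1) \<longlonglongrightarrow> min 0 1"
          by (intro tendsto_min summable_LIMSEQ_zero tendsto_const)
        then show ?thesis using True by (simp add: \<phi>_def inv)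
      qed (simp add: \<phi>_def inv)
    qed
    show "AE x in circle. norm (\<phi> (rotation (real n * \<alpha>) x)) \<le> 1" for n
      using bnd by (intro AE_I2) simp
  qed auto
  then have "(\<lambda>n::nat. LINT x|circle. \<phi> x) \<longlonglongrightarrow> 0" by (simp add: integral_rotation)
  then have "(LINT x|circle. \<phi> x) = 0" using LIMSEQ_unique tendsto_const by blast
  then have "AE x in circle. \<phi> x = 0"
    using bnd by (subst (asm) integral_nonneg_eq_0_iff_AE[OF \<phi>_int]) auto
  then show ?thesis
    using AE_space
  proof eventually_elim
    case (elim x)
    then show ?case using pos[of x] by (auto simp: \<phi>_def split: if_splits)
  qed
qed

lemma iter_rotation:
  assumes "x \<in> {0..<1}" shows "iter {0..<1} (rotation \<alpha>) n x = rotation (of_int n * \<alpha>) x"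
proof -
  have "iter {0..<1} (rotation \<alpha>) n (rotation (of_int 0 * \<alpha>) x) = rotation (of_int n * \<alpha>) x"
    by (rule iter_unique[OF bij_betw_rotation]) (simp_all add: rotation_rotation distrib_right)
  then show ?thesis using rotation_0[OF assms] by simp
qed

text \<open>The backward sums are written as forward sums of \<open>f\<close> composed with
  \<open>rotation (- \<alpha>)\<close> over the inverse rotation, so that
  \<open>AE_not_summable_orbit\<close> covers both directions.\<close>

lemma birkhoff_rotation:
  assumes "x \<in> {0..<1}"
  shows "birkhoff {0..<1} (rotation \<alpha>) f (int m) x = (\<Sum>i<m. f (rotation (real i * \<alpha>) x))"
    and "birkhoff {0..<1} (rotation \<alpha>) f (- int m) x = - (\<Sum>i<m. f (rotation (- \<alpha>) (rotation (real i * (- \<alpha>)) x)))"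
proof -
  have r: "f (rotation (of_int n * \<alpha>) x) = birkhoff {0..<1} (rotation \<alpha>) f (n + 1) x - birkhoff {0..<1} (rotation \<alpha>) f n x" for n
    by (simp add: birkhoff_add1[OF bij_betw_rotation assms] iter_rotation[OF assms])
  have 0: "birkhoff {0..<1} (rotation \<alpha>) f 0 x = 0" by (simp add: birkhoff_def)
  show "birkhoff {0..<1} (rotation \<alpha>) f (int m) x = (\<Sum>i<m. f (rotation (real i * \<alpha>) x))"
  proof (induction m)
    case (Suc m)
    then show ?case using r[of "int m"] by (simp add: add.commute)
  qed (simp add: 0)
  show "birkhoff {0..<1} (rotation \<alpha>) f (- int m) x = - (\<Sum>i<m. f (rotation (- \<alpha>) (rotation (real i * (- \<alpha>)) x)))"
  proof (induction m)
    case (Suc m)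
    have e: "- int (Suc m) + 1 = - int m" by simp
    have a: "real m * (- \<alpha>) + (- \<alpha>) = of_int (- int (Suc m)) * \<alpha>" by (simp add: algebra_simps)
    show ?case using r[of "- int (Suc m)"] Suc unfolding e sum.lessThan_Suc rotation_rotation a by linarith
  qed (simp add: 0)
qed

lemma birkhoff_measurable [measurable]:
  assumes [measurable]: "f \<in> borel_measurable circle"
  shows "birkhoff {0..<1} (rotation \<alpha>) f n \<in> borel_measurable circle"
proof -
  obtain m where "n = int m \<or> n = - int m" by (metis int_cases2)
  then show ?thesis
  proof
    assume "n = int m"
    then have "birkhoff {0..<1} (rotation \<alpha>) f n \<in> borel_measurable circle \<longleftrightarrow>
        (\<lambda>x. \<Sum>i<m. f (rotation (real i * \<alpha>) x)) \<in> borel_measurable circle"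
      by (intro measurable_cong) (simp add: birkhoff_rotation)
    then show ?thesis by simp
  next
    assume "n = - int m"
    then have "birkhoff {0..<1} (rotation \<alpha>) f n \<in> borel_measurable circle \<longleftrightarrow>
        (\<lambda>x. - (\<Sum>i<m. f (rotation (- \<alpha>) (rotation (real i * (- \<alpha>)) x)))) \<in> borel_measurable circle"
      by (intro measurable_cong) (simp add: birkhoff_rotation)
    then show ?thesis by simp
  qed
qed

text \<open>This justifies the definite description in \<open>special_flow\<close>. The step ends at
  the least index beyond \<open>m\<close> at which \<open>b\<close> exceeds \<open>t\<close>;
  monotonicity gives uniqueness.\<close>

lemma ex1_step:
  fixes b :: "int \<Rightarrow> real"
  assumes inc: "\<And>n. b n < b (n + 1)" and lo: "b m \<le> t" and hi: "t < b k"
  shows "\<exists>!n. b n \<le> t \<and> t < b (n + 1)"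
proof -
  have mono: "b i < b j" if "i < j" for i j
    using that
  proof (induction j rule: int_gr_induct)
    case base
    show ?case by (rule inc)
  next
    case (step j)
    then show ?case using inc[of j] by linarith
  qed
  have "m < k" using lo hi mono[of k m] by (cases "k = m"; cases "k < m") auto
  define l where "l = (LEAST l. t < b (m + int l))"
  have "t < b (m + int (nat (k - m)))" using hi \<open>m < k\<close> by simp
  then have l: "t < b (m + int l)" unfolding l_def by (rule LeastI)
  have "l \<noteq> 0" using l lo by (intro notI) simp
  then obtain l' where l': "l = Suc l'" by (cases l) auto
  have "\<not> t < b (m + int l')"
  proof
    assume "t < b (m + int l')"
    then have "l \<le> l'" unfolding l_def by (rule Least_le)
    then show False using l' by simp
  qed
  then have "b (m + int l') \<le> t \<and> t < b (m + int l' + 1)" using l l' by (simp add: algebra_simps)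
  moreover have "n = n'" if "b n \<le> t \<and> t < b (n + 1)" "b n' \<le> t \<and> t < b (n' + 1)" for n n'
  proof (rule ccontr)
    assume "n \<noteq> n'"
    then have "n + 1 \<le> n' \<or> n' + 1 \<le> n" by linarith
    then have "b (n + 1) \<le> b n' \<or> b (n' + 1) \<le> b n" using mono by (metis order_le_less)
    then show False using that by linarith
  qed
  ultimately show ?thesis by blast
qed

lemma not_summable_unbounded:
  fixes a :: "nat \<Rightarrow> real"
  assumes "\<not> summable a" "\<And>i. 0 \<le> a i"
  obtains m where "t < (\<Sum>i<m. a i)"
proof (rule ccontr)
  assume "\<not> thesis"
  then have "(\<Sum>i<m. a i) \<le> t" for m using that not_less by blast
  then have "summable a" by (rule summableI_nonneg_bounded[OF assms(2)])
  then show False using assms(1) by simp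
qed

text \<open>The base points over which the flow is well defined at all times. Quantifying over
  \<open>t\<close> makes this a condition on \<open>x\<close> alone, which can be moved by rotations
  and lifted along \<open>fst\<close>.\<close>

definition crossing :: "real \<Rightarrow> (real \<Rightarrow> real) \<Rightarrow> real \<Rightarrow> bool" where
  "crossing \<alpha> f x \<longleftrightarrow> (\<forall>t. \<exists>!n. birkhoff {0..<1} (rotation \<alpha>) f n x \<le> t \<and> t < birkhoff {0..<1} (rotation \<alpha>) f (n + 1) x)"

text \<open>Unboundedness above comes from the forward orbit of \<open>f\<close>, unboundedness
  below from \<open>f\<close> composed with the inverse rotation.\<close>

lemma AE_crossing:
  fixes f :: "real \<Rightarrow> real"
  assumes f: "f \<in> borel_measurable circle" and pos: "\<And>x. x \<in> {0..<1} \<Longrightarrow> 0 < f x"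
  shows "AE x in circle. crossing \<alpha> f x"
proof -
  have "(\<lambda>x. f (rotation (- \<alpha>) x)) \<in> borel_measurable circle" using f by measurable
  then have "AE x in circle. \<not> summable (\<lambda>i. f (rotation (- \<alpha>) (rotation (real i * (- \<alpha>)) x)))"
    by (rule AE_not_summable_orbit) (use pos in simp)
  moreover have "AE x in circle. \<not> summable (\<lambda>i. f (rotation (real i * \<alpha>) x))"
    by (rule AE_not_summable_orbit[OF f]) (use pos in simp)
  ultimately show ?thesis
    using AE_space
  proof eventually_elim
    case (elim x)
    then have x: "x \<in> {0..<1}" by simp
    let ?b = "\<lambda>n. birkhoff {0..<1} (rotation \<alpha>) f n x"
    show ?case
      unfolding crossing_def
    proof
      fix t
      obtain m where m: "t < (\<Sum>i<m. f (rotation (real i * \<alpha>) x))"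
        using elim(2) by (rule not_summable_unbounded) (use pos in \<open>auto intro: less_imp_le\<close>)
      obtain k where k: "- t < (\<Sum>i<k. f (rotation (- \<alpha>) (rotation (real i * (- \<alpha>)) x)))"
        using elim(1) by (rule not_summable_unbounded) (use pos in \<open>auto intro: less_imp_le\<close>)
      show "\<exists>!n. ?b n \<le> t \<and> t < ?b (n + 1)"
      proof (rule ex1_step)
        show "?b n < ?b (n + 1)" for n
          using pos[of "iter {0..<1} (rotation \<alpha>) n x"] iter_in[OF bij_betw_rotation x]
          by (simp add: birkhoff_add1[OF bij_betw_rotation x])
        show "?b (- int k) \<le> t" using k by (simp add: birkhoff_rotation[OF x])
        show "t < ?b (int m)" using m by (simp add: birkhoff_rotation[OF x])
      qed
    qed
  qed
qed

subsection \<open>The special flow over a rotation\<close>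

text \<open>Whatever integer the definite description yields, the base point stays on its orbit.
  This remains available at points not known to satisfy \<open>crossing\<close>.\<close>

lemma special_flow_rotation:
  assumes "x \<in> {0..<1}"
  obtains n where "special_flow circle (rotation \<alpha>) f t (x, s)
    = (rotation (of_int n * \<alpha>) x, t + s - birkhoff {0..<1} (rotation \<alpha>) f n x)"
  using that unfolding special_flow_def by (simp add: Let_def iter_rotation[OF assms])

lemma special_flow_in:
  assumes x: "x \<in> {0..<1}" and c: "crossing \<alpha> f x"
  shows "special_flow circle (rotation \<alpha>) f t (x, s) \<in> flow_set circle f"
proof -
  let ?b = "\<lambda>n. birkhoff {0..<1} (rotation \<alpha>) f n x"
  define n where "n = (THE n. ?b n \<le> t + s \<and> t + s < ?b (n + 1))"
  have "\<exists>!n. ?b n \<le> t + s \<and> t + s < ?b (n + 1)" using c unfolding crossing_def by blast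
  then have "?b n \<le> t + s \<and> t + s < ?b (n + 1)" unfolding n_def by (rule theI')
  moreover have "special_flow circle (rotation \<alpha>) f t (x, s) = (iter {0..<1} (rotation \<alpha>) n x, t + s - ?b n)"
    by (simp only: special_flow_def n_def Let_def prod.case space_lebesgue_on)
  ultimately show ?thesis
    using iter_in[OF bij_betw_rotation x, of \<alpha> n]
    by (auto simp: flow_set_def birkhoff_add1[OF bij_betw_rotation x])
qed

text \<open>Both sides are the representative of the orbit of
  \<open>(rotation b x, g x - s)\<close>. Facts about the flow thereby carry over to induced
  maps.\<close>

lemma induced_eq_special_flow:
  assumes x: "x \<in> {0..<1}" and c: "crossing \<alpha> f (rotation b x)"
  shows "induced circle (rotation \<alpha>) f (rotation b) g (x, s)
    = special_flow circle (rotation \<alpha>) f (s - g x) (rotation b x, 0)"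
proof -
  have "special_flow circle (rotation \<alpha>) f (s - g x) (rotation b x, 0)
      = induced circle (rotation \<alpha>) f id (\<lambda>_. - (s - g x)) (rotation b x, 0)"
    by (rule special_flow_eq_induced) (use c in \<open>auto simp: bij_betw_rotation crossing_def\<close>)
  then show ?thesis by (simp add: induced_def skew_def algebra_simps)
qed

subsection \<open>Null sets of the flow space\<close>

lemma flow_set_measurable:
  assumes [measurable]: "f \<in> borel_measurable circle"
  shows "flow_set circle f \<in> sets (circle \<Otimes>\<^sub>M lborel)"
proof -
  have "flow_set circle f = {p \<in> space (circle \<Otimes>\<^sub>M lborel). 0 \<le> snd p \<and> snd p < f (fst p)}"
    by (auto simp: flow_set_def space_pair_measure)
  also have "\<dots> \<in> sets (circle \<Otimes>\<^sub>M lborel)" by measurable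
  finally show ?thesis .
qed

lemma emeasure_flow_set:
  assumes f: "f \<in> borel_measurable circle"
  shows "emeasure (circle \<Otimes>\<^sub>M lborel) (flow_set circle f) = (\<integral>\<^sup>+x. ennreal (f x) \<partial>circle)"
  unfolding lborel.emeasure_pair_measure_alt[OF flow_set_measurable[OF f]]
proof (rule nn_integral_cong)
  fix x assume "x \<in> space circle"
  then have "Pair x -` flow_set circle f = {0..<f x}" by (auto simp: flow_set_def)
  then show "emeasure lborel (Pair x -` flow_set circle f) = ennreal (f x)"
    by (cases "0 \<le> f x") (auto simp: ennreal_neg)
qed

text \<open>The total mass is finite, so the normalizing factor is not \<open>0\<close> and scaling
  keeps the null sets.\<close>

lemma AE_flow_space:
  assumes f: "f \<in> borel_measurable circle" "integrable circle f"
  shows "(AE p in flow_space circle f. P p) \<longleftrightarrow> (AE p in circle \<Otimes>\<^sub>M lborel. p \<in> flow_set circle f \<longrightarrow> P p)"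
proof -
  let ?M = "restrict_space (circle \<Otimes>\<^sub>M lborel) (flow_set circle f)"
  have "(\<integral>\<^sup>+x. ennreal (f x) \<partial>circle) \<le> (\<integral>\<^sup>+x. ennreal (norm (f x)) \<partial>circle)"
    by (intro nn_integral_mono ennreal_leI) auto
  also have "\<dots> < \<infinity>" using f(2) by (simp add: integrable_iff_bounded)
  finally have fin: "emeasure (circle \<Otimes>\<^sub>M lborel) (flow_set circle f) < \<infinity>"
    by (simp add: emeasure_flow_set f)
  define c where "c = 1 / emeasure (circle \<Otimes>\<^sub>M lborel) (flow_set circle f)"
  have "c \<noteq> 0" using fin by (auto simp: c_def divide_ennreal_def)
  then have "null_sets (scale_measure c ?M) = null_sets ?M" by (auto simp: null_sets_def)
  then have "(AE p in flow_space circle f. P p) \<longleftrightarrow> (AE p in ?M. P p)"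
    unfolding flow_space_def c_def[symmetric] by (simp add: eventually_ae_filter space_scale_measure)
  also have "\<dots> \<longleftrightarrow> (AE p in circle \<Otimes>\<^sub>M lborel. p \<in> flow_set circle f \<longrightarrow> P p)"
    using flow_set_measurable[OF f(1)] by (intro AE_restrict_space_iff) simp
  finally show ?thesis .
qed

lemma AE_fst:
  assumes "AE x in circle. P x" shows "AE p in circle \<Otimes>\<^sub>M (lborel :: real measure). P (fst p)"
proof -
  obtain N where N: "{x \<in> space circle. \<not> P x} \<subseteq> N" "N \<in> null_sets circle"
    using assms by (auto elim!: AE_E simp: null_sets_def)
  then have "N \<times> UNIV \<in> null_sets (circle \<Otimes>\<^sub>M (lborel :: real measure))"
    by (intro lborel.times_in_null_sets1) auto
  then show ?thesis by (rule AE_I') (use N(1) in \<open>auto simp: space_pair_measure\<close>)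
qed

text \<open>Allows a condition that does not depend on the point to be concluded from its validity
  almost everywhere.\<close>

lemma flow_space_nontrivial:
  assumes f: "f \<in> borel_measurable circle" "integrable circle f" and pos: "\<And>x. x \<in> {0..<1} \<Longrightarrow> 0 < f x"
  shows "\<not> (AE p in flow_space circle f. False)"
proof
  assume "AE p in flow_space circle f. False"
  then have "AE p in circle \<Otimes>\<^sub>M lborel. p \<notin> flow_set circle f" by (simp add: AE_flow_space[OF f])
  then have "emeasure (circle \<Otimes>\<^sub>M lborel) (flow_set circle f) = 0"
    using AE_iff_null_sets[OF flow_set_measurable[OF f(1)]] by (simp add: null_sets_def)
  then have "AE x in circle. ennreal (f x) = 0"
    using f(1) by (simp add: emeasure_flow_set nn_integral_0_iff_AE)
  then have "AE x in circle. False"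
    using AE_space by eventually_elim (use pos in \<open>force simp: ennreal_eq_0_iff\<close>)
  then show False using emeasure_circle by (simp add: eventually_False ae_filter_eq_bot_iff)
qed

text \<open>Skew products over a rotation preserve the product measure: by Fubini's theorem the
  vertical sections are only translated, and the base is rotated.\<close>

lemma AE_skew_rotation:
  assumes [measurable]: "h \<in> borel_measurable circle"
    and P: "AE p in circle \<Otimes>\<^sub>M lborel. P p"
  shows "AE p in circle \<Otimes>\<^sub>M lborel. P (rotation a (fst p), snd p - h (fst p))"
proof -
  obtain N where N: "{p \<in> space (circle \<Otimes>\<^sub>M lborel). \<not> P p} \<subseteq> N" "N \<in> sets (circle \<Otimes>\<^sub>M lborel)"
      "emeasure (circle \<Otimes>\<^sub>M lborel) N = 0"
    using P by (auto elim!: AE_E)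
  let ?\<Phi> = "\<lambda>p. (rotation a (fst p), snd p - h (fst p))"
  have \<Phi>: "?\<Phi> \<in> circle \<Otimes>\<^sub>M lborel \<rightarrow>\<^sub>M circle \<Otimes>\<^sub>M lborel" by measurable
  define N' where "N' = ?\<Phi> -` N \<inter> space (circle \<Otimes>\<^sub>M lborel)"
  have N': "N' \<in> sets (circle \<Otimes>\<^sub>M lborel)" unfolding N'_def by (rule measurable_sets[OF \<Phi> N(2)])
  have "emeasure (circle \<Otimes>\<^sub>M lborel) N' = (\<integral>\<^sup>+x. emeasure lborel (Pair x -` N') \<partial>circle)"
    by (rule lborel.emeasure_pair_measure_alt[OF N'])
  also have "\<dots> = (\<integral>\<^sup>+x. emeasure lborel (Pair (rotation a x) -` N) \<partial>circle)"
  proof (rule nn_integral_cong)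
    fix x assume "x \<in> space circle"
    have B: "Pair (rotation a x) -` N \<in> sets borel" using sets_Pair1[OF N(2)] by simp
    have "Pair x -` N' = (\<lambda>s. - h x + s) -` (Pair (rotation a x) -` N) \<inter> space lborel"
      using \<open>x \<in> space circle\<close> by (auto simp: N'_def space_pair_measure)
    also have "emeasure lborel \<dots> = emeasure (distr lborel borel (\<lambda>s. - h x + s)) (Pair (rotation a x) -` N)"
      using B by (intro emeasure_distr[symmetric]) auto
    also have "\<dots> = emeasure lborel (Pair (rotation a x) -` N)" by (simp only: lborel_distr_plus)
    finally show "emeasure lborel (Pair x -` N') = emeasure lborel (Pair (rotation a x) -` N)" .
  qed
  also have "\<dots> = (\<integral>\<^sup>+x. emeasure lborel (Pair x -` N) \<partial>distr circle circle (rotation a))"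
    using lborel.measurable_emeasure_Pair[OF N(2)]
    by (intro nn_integral_distr[symmetric, OF measurable_rotation]) simp
  also have "\<dots> = emeasure (circle \<Otimes>\<^sub>M lborel) N"
    unfolding distr_rotation by (rule lborel.emeasure_pair_measure_alt[OF N(2), symmetric])
  finally have "N' \<in> null_sets (circle \<Otimes>\<^sub>M lborel)" using N' N(3) by (simp add: null_sets_def)
  then show ?thesis
  proof (rule AE_I')
    have "?\<Phi> p \<in> space (circle \<Otimes>\<^sub>M lborel)" if "p \<in> space (circle \<Otimes>\<^sub>M lborel)" for p
      using measurable_space[OF \<Phi> that] .
    then show "{p \<in> space (circle \<Otimes>\<^sub>M lborel). \<not> P (?\<Phi> p)} \<subseteq> N'" using N(1) unfolding N'_def by blast
  qed
qed

text \<open>At each good point an induced map coincides with one of the countably many skew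
  rotations indexed by \<open>n\<close>, and each of these pulls null sets back to null sets. That
  the image lies in the flow set comes from \<open>crossing\<close>.\<close>

lemma AE_induced:
  assumes f: "f \<in> borel_measurable circle" "integrable circle f" and pos: "\<And>x. x \<in> {0..<1} \<Longrightarrow> 0 < f x"
    and g[measurable]: "g \<in> borel_measurable circle"
    and P: "AE p in flow_space circle f. P p"
  shows "AE p in flow_space circle f. P (induced circle (rotation \<alpha>) f (rotation b) g p)"
proof -
  note [measurable] = f(1)
  let ?b = "birkhoff {0..<1} (rotation \<alpha>) f"
  let ?R = "\<lambda>p. p \<in> flow_set circle f \<longrightarrow> P p"
  have "AE p in circle \<Otimes>\<^sub>M lborel. ?R p" using P by (simp add: AE_flow_space[OF f])
  then have "AE p in circle \<Otimes>\<^sub>M lborel.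
      ?R (rotation (b + of_int n * \<alpha>) (fst p), snd p - (g (fst p) + ?b n (rotation b (fst p))))" for n
    by (intro AE_skew_rotation) measurable
  then have all: "AE p in circle \<Otimes>\<^sub>M lborel. \<forall>n.
      ?R (rotation (b + of_int n * \<alpha>) (fst p), snd p - (g (fst p) + ?b n (rotation b (fst p))))"
    by (simp add: AE_all_countable)
  have "AE x in circle. crossing \<alpha> f x" by (rule AE_crossing[OF f(1)]) (use pos in simp)
  from AE_fst[OF AE_rotation[OF this, of b]] all have "AE p in circle \<Otimes>\<^sub>M lborel.
      p \<in> flow_set circle f \<longrightarrow> P (induced circle (rotation \<alpha>) f (rotation b) g p)"
    using AE_space
  proof eventually_elim
    case (elim p)
    obtain x s where p: "p = (x, s)" by (cases p)
    with elim(1,3) have x: "x \<in> {0..<1}" and c: "crossing \<alpha> f (rotation b x)" by (auto simp: space_pair_measure)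
    have r: "rotation b x \<in> {0..<1}" by simp
    obtain n where n: "special_flow circle (rotation \<alpha>) f (s - g x) (rotation b x, 0)
        = (rotation (of_int n * \<alpha>) (rotation b x), s - g x + 0 - ?b n (rotation b x))"
      using special_flow_rotation[OF r] by blast
    have "induced circle (rotation \<alpha>) f (rotation b) g p
        = (rotation (b + of_int n * \<alpha>) x, s - (g x + ?b n (rotation b x)))"
      unfolding p induced_eq_special_flow[OF x c] n by (simp add: rotation_rotation)
    moreover have "induced circle (rotation \<alpha>) f (rotation b) g p \<in> flow_set circle f"
      unfolding p induced_eq_special_flow[OF x c] by (rule special_flow_in[OF r c])
    ultimately show ?case using elim(2) by (auto simp: p)
  qed
  then show ?thesis by (simp add: AE_flow_space[OF f])
qed

subsection \<open>Cosets of the flow\<close>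

lemma mult_lift_centralizer:
  "A \<otimes>\<^bsub>lift_centralizer M T f\<^esub> B = {k. \<exists>a\<in>A. \<exists>b\<in>B. AE x in flow_space M f. k x = a (b x)}"
  by (simp add: lift_centralizer_def Aut_def)

text \<open>Only first coordinates are compared. They lie on the orbits of
  \<open>rotation b x\<close> and \<open>rotation b' x\<close> under the rotation by \<alpha>, so
  one common value determines \<open>b\<close> up to that rotation.\<close>

lemma same_coset:
  fixes f g g' :: "real \<Rightarrow> real"
  assumes f: "f \<in> borel_measurable circle" "integrable circle f" and pos: "\<And>x. x \<in> {0..<1} \<Longrightarrow> 0 < f x"
    and g: "g' \<in> borel_measurable circle"
    and b: "b \<in> {0..<1}"
    and eq: "flow_subgroup circle (rotation \<alpha>) f #>\<^bsub>lift_centralizer circle (rotation \<alpha>) f\<^esub>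
        ae_class (flow_space circle f) (induced circle (rotation \<alpha>) f (rotation b) g)
      = flow_subgroup circle (rotation \<alpha>) f #>\<^bsub>lift_centralizer circle (rotation \<alpha>) f\<^esub>
        ae_class (flow_space circle f) (induced circle (rotation \<alpha>) f (rotation b') g')"
  shows "b \<in> range (\<lambda>n::int. frac (b' + of_int n * \<alpha>))"
proof -
  let ?F = "flow_space circle f" and ?G = "lift_centralizer circle (rotation \<alpha>) f"
  let ?T = "special_flow circle (rotation \<alpha>) f"
  let ?I = "induced circle (rotation \<alpha>) f (rotation b) g" and ?I' = "induced circle (rotation \<alpha>) f (rotation b') g'"
  \<comment> \<open>Time \<open>0\<close> serves as a member of the subgroup; like any other time it
    is used only as a motion along orbits.\<close>
  have "ae_class ?F (?T 0) \<otimes>\<^bsub>?G\<^esub> ae_class ?F ?I \<in> flow_subgroup circle (rotation \<alpha>) f #>\<^bsub>?G\<^esub> ae_class ?F ?I"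
    by (auto simp: r_coset_def flow_subgroup_def)
  then obtain t where t: "ae_class ?F (?T 0) \<otimes>\<^bsub>?G\<^esub> ae_class ?F ?I = ae_class ?F (?T t) \<otimes>\<^bsub>?G\<^esub> ae_class ?F ?I'"
    unfolding eq by (auto simp: r_coset_def flow_subgroup_def)
  have "(\<lambda>p. ?T 0 (?I p)) \<in> ae_class ?F (?T 0) \<otimes>\<^bsub>?G\<^esub> ae_class ?F ?I"
    unfolding mult_lift_centralizer
    by (intro CollectI bexI[of _ "?T 0"] bexI[of _ ?I]) (simp_all add: ae_class_def)
  then have "(\<lambda>p. ?T 0 (?I p)) \<in> ae_class ?F (?T t) \<otimes>\<^bsub>?G\<^esub> ae_class ?F ?I'" by (simp only: t)
  then obtain u v where uv_in: "u \<in> ae_class ?F (?T t)" "v \<in> ae_class ?F ?I'"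
    and uv: "AE p in ?F. ?T 0 (?I p) = u (v p)"
    unfolding mult_lift_centralizer by (elim CollectE bexE)
  then have u: "AE p in ?F. u p = ?T t p" and v: "AE p in ?F. v p = ?I' p"
    by (simp_all only: ae_class_def mem_Collect_eq)
  \<comment> \<open>\<open>u\<close> agrees with the flow only almost everywhere, so substituting
    \<open>?I'\<close> requires that induced maps pull null sets back to null sets.\<close>
  have "AE p in ?F. u (?I' p) = ?T t (?I' p)"
    by (rule AE_induced[OF f _ g u]) (use pos in simp)
  with v uv have "AE p in ?F. ?T 0 (?I p) = ?T t (?I' p)" by eventually_elim simp
  then have "AE p in circle \<Otimes>\<^sub>M lborel. p \<in> flow_set circle f \<longrightarrow> ?T 0 (?I p) = ?T t (?I' p)"
    by (simp add: AE_flow_space[OF f])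
  moreover have "AE x in circle. crossing \<alpha> f x" by (rule AE_crossing[OF f(1)]) (use pos in simp)
  note AE_fst[OF AE_rotation[OF this, of b]] AE_fst[OF AE_rotation[OF this, of b']]
  ultimately have "AE p in circle \<Otimes>\<^sub>M lborel. p \<in> flow_set circle f \<longrightarrow> b \<in> range (\<lambda>n::int. frac (b' + of_int n * \<alpha>))"
    using AE_space
  proof eventually_elim
    case (elim p)
    show ?case
    proof
      assume pF: "p \<in> flow_set circle f"
      obtain x s where p: "p = (x, s)" by (cases p)
      have x: "x \<in> {0..<1}" using elim(4) p by (auto simp: space_pair_measure)
      have c: "crossing \<alpha> f (rotation b x)" "crossing \<alpha> f (rotation b' x)" using elim(2,3) p by simp_all
      have fst_T: "\<exists>n. fst (?T r (y, z)) = rotation (of_int n * \<alpha>) y" if "y \<in> {0..<1}" for r y z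
        using special_flow_rotation[OF that, of \<alpha> f r z] by (metis fst_conv)
      have fst_TT: "\<exists>n. fst (?T r (?T r' (y, z))) = rotation (of_int n * \<alpha>) y" if y: "y \<in> {0..<1}" for r r' y z
      proof -
        obtain n where n: "fst (?T r' (y, z)) = rotation (of_int n * \<alpha>) y" using fst_T[OF y] by blast
        then have "fst (?T r' (y, z)) \<in> {0..<1}" by simp
        from fst_T[OF this, of r "snd (?T r' (y, z))"]
        obtain m where "fst (?T r (?T r' (y, z))) = rotation (of_int m * \<alpha>) (rotation (of_int n * \<alpha>) y)"
          unfolding n prod.collapse by (metis n prod.collapse)
        then have "fst (?T r (?T r' (y, z))) = rotation (of_int (n + m) * \<alpha>) y"
          by (simp add: rotation_rotation distrib_right)
        then show ?thesis by blast
      qed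
      have r: "rotation b x \<in> {0..<1}" "rotation b' x \<in> {0..<1}" by simp_all
      have "fst (?T 0 (?I p)) = fst (?T t (?I' p))" using elim(1) pF by simp
      then obtain n m where "rotation (of_int n * \<alpha>) (rotation b x) = rotation (of_int m * \<alpha>) (rotation b' x)"
        unfolding p induced_eq_special_flow[OF x c(1)] induced_eq_special_flow[OF x c(2)]
        using fst_TT[OF r(1)] fst_TT[OF r(2)] by metis
      then have "frac (x + (b + of_int n * \<alpha>)) = frac (x + (b' + of_int m * \<alpha>))"
        unfolding rotation_rotation by (simp add: rotation_def)
      \<comment> \<open>Rotating both sides by \<open>- x - of_int n * \<alpha>\<close> eliminates
        the point \<open>x\<close>.\<close>
      then have "rotation (- x - of_int n * \<alpha>) (frac (x + (b + of_int n * \<alpha>)))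
          = rotation (- x - of_int n * \<alpha>) (frac (x + (b' + of_int m * \<alpha>)))" by simp
      then have "rotation (- x - of_int n * \<alpha>) (rotation (b + of_int n * \<alpha>) x)
          = rotation (- x - of_int n * \<alpha>) (rotation (b' + of_int m * \<alpha>) x)" by (simp add: rotation_def)
      then have "frac b = frac (b' + of_int (m - n) * \<alpha>)"
        unfolding rotation_rotation by (simp add: rotation_def algebra_simps)
      moreover have "frac b = b" using b by (simp add: frac_eq)
      ultimately have "b = frac (b' + of_int (m - n) * \<alpha>)" by simp
      then show "b \<in> range (\<lambda>n::int. frac (b' + of_int n * \<alpha>))" by (rule range_eqI)
    qed
  qed
  then have "AE p in ?F. b \<in> range (\<lambda>n::int. frac (b' + of_int n * \<alpha>))"
    by (simp only: AE_flow_space[OF f])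
  then show ?thesis
    using flow_space_nontrivial[OF f pos] by (cases "b \<in> range (\<lambda>n::int. frac (b' + of_int n * \<alpha>))") simp_all
qed

text \<open>Mapping \<open>\<beta>\<close> to the coset of a chosen lift has countable fibres,
  because by \<open>same_coset\<close> a fibre lies on a single orbit of the rotation by \<alpha>.
  Countably many cosets would therefore make \<open>B\<close> countable.\<close>

lemma uncountable_liftable_cosets:
  fixes f :: "real \<Rightarrow> real"
  assumes f: "f \<in> borel_measurable circle" "integrable circle f" and pos: "\<And>x. x \<in> {0..<1} \<Longrightarrow> 0 < f x"
    and B: "uncountable B" "B \<subseteq> {0..<1}"
    and g: "\<And>\<beta>. \<beta> \<in> B \<Longrightarrow> \<exists>g. g \<in> borel_measurable circle \<and>
       (AE x in circle. f (rotation \<beta> x) - f x = g (rotation \<alpha> x) - g x)"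
  shows "uncountable (carrier (lift_centralizer circle (rotation \<alpha>) f Mod flow_subgroup circle (rotation \<alpha>) f))"
proof
  let ?G = "lift_centralizer circle (rotation \<alpha>) f" and ?H = "flow_subgroup circle (rotation \<alpha>) f"
  assume cnt: "countable (carrier (?G Mod ?H))"
  obtain \<gamma> where \<gamma>: "\<And>\<beta>. \<beta> \<in> B \<Longrightarrow> \<gamma> \<beta> \<in> borel_measurable circle"
    "\<And>\<beta>. \<beta> \<in> B \<Longrightarrow> AE x in circle. f (rotation \<beta> x) - f x = \<gamma> \<beta> (rotation \<alpha> x) - \<gamma> \<beta> x"
    using g by metis
  define \<Psi> where "\<Psi> = (\<lambda>\<beta>. ?H #>\<^bsub>?G\<^esub> ae_class (flow_space circle f) (induced circle (rotation \<alpha>) f (rotation \<beta>) (\<gamma> \<beta>)))"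
  have "\<Psi> ` B \<subseteq> carrier (?G Mod ?H)"
  proof
    fix C assume "C \<in> \<Psi> ` B"
    then obtain \<beta> where \<beta>: "\<beta> \<in> B" "C = \<Psi> \<beta>" by blast
    have "AE x in circle. rotation \<beta> (rotation \<alpha> x) = rotation \<alpha> (rotation \<beta> x)"
      by (simp add: rotation_rotation add.commute)
    then have "ae_class (flow_space circle f) (induced circle (rotation \<alpha>) f (rotation \<beta>) (\<gamma> \<beta>)) \<in> carrier ?G"
      using \<gamma>[OF \<beta>(1)] automorphism_rotation[of \<beta>] unfolding lift_centralizer_def by auto
    then show "C \<in> carrier (?G Mod ?H)"
      unfolding \<beta>(2) \<Psi>_def FactGroup_def RCOSETS_def by auto
  qed
  then have "countable (\<Psi> ` B)" using cnt countable_subset by blast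
  moreover have "countable {\<beta> \<in> B. \<Psi> \<beta> = C}" if "C \<in> \<Psi> ` B" for C
  proof -
    from that obtain \<beta>' where \<beta>': "\<beta>' \<in> B" "C = \<Psi> \<beta>'" by blast
    have "{\<beta> \<in> B. \<Psi> \<beta> = C} \<subseteq> range (\<lambda>n::int. frac (\<beta>' + of_int n * \<alpha>))"
      using same_coset[OF f pos \<gamma>(1)[OF \<beta>'(1)]] B(2) unfolding \<beta>'(2) \<Psi>_def by blast
    then show ?thesis by (rule countable_subset) simp
  qed
  ultimately have "countable (\<Union>C\<in>\<Psi> ` B. {\<beta> \<in> B. \<Psi> \<beta> = C})" by (rule countable_UN)
  moreover have "B \<subseteq> (\<Union>C\<in>\<Psi> ` B. {\<beta> \<in> B. \<Psi> \<beta> = C})" by blast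
  ultimately show False using B(1) countable_subset by blast
qed

theorem proposition9p5:
  fixes f :: "real \<Rightarrow> real" and \<alpha> :: real
  assumes "\<And>x. x \<in> {0..<1} \<Longrightarrow> 0 < f x"
    and "square_integrable circle f"
    and "(\<lambda>n::int. norm (fourier_coeff f n)) \<in> o[sup at_bot at_top](\<lambda>n. 1 / \<bar>real_of_int n\<bar>)"
    and "\<alpha> \<notin> \<rat>"
  shows "uncountable {\<beta> \<in> {0..<1}. \<exists>g. square_integrable circle g \<and>
             (AE x in circle. f (rotation \<beta> x) - f x = g (rotation \<alpha> x) - g x)} \<and>
         uncountable (carrier (lift_centralizer circle (rotation \<alpha>) f
                                 Mod flow_subgroup circle (rotation \<alpha>) f))"
proof
  show B: "uncountable {\<beta> \<in> {0..<1}. \<exists>g. square_integrable circle g \<and>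
             (AE x in circle. f (rotation \<beta> x) - f x = g (rotation \<alpha> x) - g x)}" (is "uncountable ?B")
    by (rule uncountable_cocycle_translations[OF assms(2-4)])
  show "uncountable (carrier (lift_centralizer circle (rotation \<alpha>) f
                                 Mod flow_subgroup circle (rotation \<alpha>) f))"
  proof (rule uncountable_liftable_cosets[OF sq_intD(1,3)[OF assms(2)] _ B])
    show "0 < f x" if "x \<in> {0..<1}" for x using that by (rule assms(1))
    show "\<exists>g. g \<in> borel_measurable circle \<and>
        (AE x in circle. f (rotation \<beta> x) - f x = g (rotation \<alpha> x) - g x)" if "\<beta> \<in> ?B" for \<beta>
      using that sq_intD(1) by blast
  qed blast
qed

end
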